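(* Consider the distributed problem of minimizing $f=\sum_{i\in V}f_i$ over $X=\bigcap_{i\in V}X_i$ and the random projected subgradient algorithm described in the context. Assume: (1) each $X_i^j\subset\mathbb{R}^d$ ($i\in V$, $j\in I_i$) is closed and convex, and $X\neq\emptyset$; each $f_i:\mathbb{R}^d\to\mathbb{R}$ is convex; for each $i\in V$ there is $M_i\in\mathbb{R}$ with $\|g\|\le M_i$ for all $x\in X_i$ and all $g\in\partial f_i(x)$; for each $i\in V$ there is $C_i\in\mathbb{R}$ with $\|g\|\le C_i$ for all $k\ge0$ and all $g\in\partial f_i(v_i(k))$; and the solution set $X^\star$ is nonempty; (2) there is an integer $Q\ge 1$ such that for every $k\ge 0$ the directed graph $(V,\bigcap_{l=0}^{Q-1}E(k+l))$ is strongly connected; (3) the random variables $\Omega_i(k)$ ($i\in V$, $k\ge0$) are independent, and independent of the initial points $x_i(0)$ ($i\in V$); for each $i$ the variables $\Omega_i(k)$, $k\ge 0$, are identically distributed; and $\Pr\{\Omega_i(k)=j\}>0$ for all $i\in V$, $j\in I_i$; (4) there is $c>0$ such that $\mathrm{d}(x,X)^2\le c\,\mathrm{E}[\mathrm{d}(x,X_i^{\Omega_i(k)})^2]$ for all $i\in V$, $x\in\mathbb{R}^d$, $k\ge 0$; (5) for all $k\ge 0$: $w_{ij}(k)\ge 0$ for all $i,j\in V$, $w_{ij}(k)=0$ if $j\notin N_i(k)$, $\sum_{j\in V}w_{ij}(k)=1$ for all $i$, and $\sum_{i\in V}w_{ij}(k)=1$ for all $j$; moreover there is $w\in(0,1)$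 with $w_{ij}(k)\ge w$ for all $i\in V$, $k\ge0$, $j\in N_i(k)$; and $(\alpha_k)_{k\ge0}\subset(0,\infty)$ satisfies $\sum_{k}\alpha_k=\infty$ and $\sum_k\alpha_k^2<\infty$. Then there is a random point $x^\star\in X^\star$ such that, for every $i\in V$, the sequence $(x_i(k))_{k\ge0}$ generated by the algorithm converges almost surely to $x^\star$.
   Context: Setting. $V=\{1,\dots,m\}$ is a set of users. $I=\{1,\dots,n\}$ is the disjoint union of nonempty sets $I_i$ ($i\in V$). User $i$ has a function $f_i:\mathbb{R}^d\to\mathbb{R}$ and sets $X_i^j\subset\mathbb{R}^d$ ($j\in I_i$); $X_i:=\bigcap_{j\in I_i}X_i^j$, $X:=\bigcap_{i\in V}X_i$, $f:=\sum_{i\in V}f_i$, $f^\star:=\inf_{x\in X}f(x)$, $X^\star:=\{x\in X: f(x)=f^\star\}$. Notation. $\mathbb{R}^d$ carries the Euclidean norm. For a nonempty closed convex $C$, $P_C$ is the metric (nearest-point) projection onto $C$ and $\mathrm{d}(x,C)=\inf_{y\in C}\|x-y\|$. $\partial f_i$ is the convex subdifferential. Network. At each time $k\ge0$ there is a directed graph $(V,E(k))$, $E(k)\subset V\times V$, where $(i,j)\in E(k)$ means $i$ receives information from $j$; $N_i(k):=\{j\in V:(i,j)\in E(k)\}$, and $i\in N_i(k)$ always. $w_{ij}(k)$ are weights and $\alpha_k>0$ step sizes (deterministic). $\Omega_i(k)$ is a random variable with values in $I_i$. Algorithm (random projected subgradient algorithm). Initial points $x_i(0)\in\mathbb{R}^d$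 ($i\in V$) are arbitrary (possibly random). For $k\ge0$ and $i\in V$, $$v_i(k):=\sum_{j\in N_i(k)}w_{ij}(k)x_j(k),\quad g_i(k)\in\partial f_i(v_i(k)),\quad x_i(k+1):=P_{X_i^{\Omega_i(k)}}\big(v_i(k)-\alpha_kg_i(k)\big).$$ $\mathcal{F}_k$ is the $\sigma$-algebra generated by $x_i(0)$ ($i\in V$) and $\Omega_i(l)$ ($i\in V$, $0\le l\le k-1$); the subgradient $g_i(k)$ is chosen to be $\mathcal{F}_k$-measurable (so the iterates up to time $k$ are determined by $\mathcal{F}_k$). *)

theory Defs
  imports
    "Graph_Theory.Digraph_Component"
    "HOL-Probability.Probability"
begin

definition subdifferential :: "('a::real_inner \<Rightarrow> real) \<Rightarrow> 'a \<Rightarrow> 'a set" where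
  "subdifferential h x = {g. \<forall>y. h y \<ge> h x + g \<bullet> (y - x)}"

text \<open>
  \<open>V\<close> is the set of users, \<open>J i\<close> the index set of user \<open>i\<close>, and \<open>Xc i j\<close>, for \<open>j \<in> J i\<close>, are
  the constraint sets of user \<open>i\<close>.
\<close>

definition user_set :: "('i \<Rightarrow> 'j set) \<Rightarrow> ('i \<Rightarrow> 'j \<Rightarrow> 'a set) \<Rightarrow> 'i \<Rightarrow> 'a set" where
  "user_set J Xc i = (\<Inter>j\<in>J i. Xc i j)"

definition feasible_set :: "'i set \<Rightarrow> ('i \<Rightarrow> 'j set) \<Rightarrow> ('i \<Rightarrow> 'j \<Rightarrow> 'a set) \<Rightarrow> 'a set" where
  "feasible_set V J Xc = (\<Inter>i\<in>V. user_set J Xc i)"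

definition objective :: "'i set \<Rightarrow> ('i \<Rightarrow> 'a \<Rightarrow> real) \<Rightarrow> 'a \<Rightarrow> real" where
  "objective V f x = (\<Sum>i\<in>V. f i x)"

text \<open>
  The infimum is taken in the extended reals: on \<open>real\<close>, the value of \<open>Inf\<close> on a set that is
  unbounded below is unspecified and could be attained, whereas here it is \<open>-\<infinity>\<close>.
\<close>

definition optimal_value ::
    "'i set \<Rightarrow> ('i \<Rightarrow> 'j set) \<Rightarrow> ('i \<Rightarrow> 'j \<Rightarrow> 'a set) \<Rightarrow> ('i \<Rightarrow> 'a \<Rightarrow> real) \<Rightarrow> ereal" where
  "optimal_value V J Xc f = (INF x\<in>feasible_set V J Xc. ereal (objective V f x))"

definition solution_set ::
    "'i set \<Rightarrow> ('i \<Rightarrow> 'j set) \<Rightarrow> ('i \<Rightarrow> 'j \<Rightarrow> 'a set) \<Rightarrow> ('i \<Rightarrow> 'a \<Rightarrow> real) \<Rightarrow> 'a set" where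
  "solution_set V J Xc f =
     {x \<in> feasible_set V J Xc. ereal (objective V f x) = optimal_value V J Xc f}"

text \<open>An edge \<open>(i, j)\<close> means that \<open>i\<close> receives information from \<open>j\<close>.\<close>

definition neighbours :: "'i set \<Rightarrow> ('i \<times> 'i) set \<Rightarrow> 'i \<Rightarrow> 'i set" where
  "neighbours V E i = {j \<in> V. (i, j) \<in> E}"

text \<open>
  The \<open>\<sigma>\<close>-algebra generated by the initial points \<open>x0 i\<close> and by the draws \<open>\<Omega> i l\<close> with \<open>l < k\<close>.
\<close>

definition history ::
    "'w measure \<Rightarrow> 'i set \<Rightarrow> ('i \<Rightarrow> 'j set) \<Rightarrow> ('i \<Rightarrow> 'w \<Rightarrow> 'a::topological_space)
      \<Rightarrow> ('i \<Rightarrow> nat \<Rightarrow> 'w \<Rightarrow> 'j) \<Rightarrow> nat \<Rightarrow> 'w measure" where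
  "history M V J x0 \<Omega> k = sigma (space M)
     ({x0 i -` B \<inter> space M | i B. i \<in> V \<and> B \<in> sets borel} \<union>
      {\<Omega> i l -` A \<inter> space M | i l A. i \<in> V \<and> l < k \<and> A \<subseteq> J i})"

end

theory Submission
  imports Defs
begin

text \<open>
  Randomness enters only through the claim that almost surely
  \<open>\<Sum>k. \<Sum>i\<in>V. d(v\<^sub>i(k), X)\<^sup>2\<close> is finite. Since \<open>\<Omega>\<^sub>i(k)\<close> is independent of the history up to
  time \<open>k\<close>, the regularity condition makes the random projection decrease the expected squared
  distance to \<open>X\<close> by a fixed fraction, up to an error \<open>O(\<alpha>\<^sub>k\<^sup>2)\<close>. The initial points need not be
  integrable, so expectations are taken on the events that all initial points have norm at most
  \<open>R\<close>, which exhaust the probability space.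

  On a trajectory where the sum is finite the remaining argument is deterministic. Every graph \<open>E(k)\<close>
  is itself strongly connected, so one step of mixing contracts the disagreement
  \<open>\<Sum>i. \<parallel>x\<^sub>i(k) - m(k)\<parallel>\<^sup>2\<close> around the mean \<open>m(k)\<close> by a fixed factor, and the disagreement is summable.
  With \<open>s(k) = P\<^sub>X(m(k))\<close>, the quantity \<open>\<Sum>i. \<parallel>x\<^sub>i(k) - z\<parallel>\<^sup>2\<close> for \<open>z \<in> X\<^sup>\<star>\<close> drops by
  \<open>2 \<alpha>\<^sub>k (f(s(k)) - f\<^sup>\<star>)\<close> at each step up to a summable error. Hence it converges, and since
  \<open>\<Sum>k. \<alpha>\<^sub>k\<close> diverges, \<open>s(k)\<close> has an accumulation point in \<open>X\<^sup>\<star>\<close>, to which all iterates then converge.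
\<close>

section \<open>Mixing by doubly stochastic weights\<close>

text \<open>Expand each squared distance in the double sum: since the weights total 1, both diagonal
  parts give the weighted sum of squared norms, and the cross terms assemble into the squared norm
  of the combination. The exact defect is kept, rather than only convexity, because the contraction
  of the disagreement is read off from it.\<close>

lemma norm_convex_combination:
  fixes u :: "'i \<Rightarrow> 'a::real_inner"
  assumes "sum w V = 1"
  shows "(norm (\<Sum>j\<in>V. w j *\<^sub>R u j))\<^sup>2 =
    (\<Sum>j\<in>V. w j * (norm (u j))\<^sup>2) - (\<Sum>j\<in>V. \<Sum>l\<in>V. w j * w l * (norm (u j - u l))\<^sup>2) / 2"
proof -
  have "(\<Sum>j\<in>V. \<Sum>l\<in>V. w j * w l * (norm (u j - u l))\<^sup>2) =
      (\<Sum>j\<in>V. \<Sum>l\<in>V. w l * (w j * (norm (u j))\<^sup>2) + w j * (w l * (norm (u l))\<^sup>2)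
        - 2 * ((w j *\<^sub>R u j) \<bullet> (w l *\<^sub>R u l)))"
    by (intro sum.cong refl) (simp add: power2_norm_eq_inner inner_diff inner_commute algebra_simps)
  also have "\<dots> = (\<Sum>j\<in>V. \<Sum>l\<in>V. w l * (w j * (norm (u j))\<^sup>2))
      + (\<Sum>j\<in>V. \<Sum>l\<in>V. w j * (w l * (norm (u l))\<^sup>2))
      - 2 * (\<Sum>j\<in>V. \<Sum>l\<in>V. (w j *\<^sub>R u j) \<bullet> (w l *\<^sub>R u l))"
    by (simp add: sum.distrib sum_subtractf sum_distrib_left)
  also have "(\<Sum>j\<in>V. \<Sum>l\<in>V. w l * (w j * (norm (u j))\<^sup>2)) = (\<Sum>j\<in>V. w j * (norm (u j))\<^sup>2)"
    using assms by (simp add: sum_distrib_right[symmetric])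
  also have "(\<Sum>j\<in>V. \<Sum>l\<in>V. w j * (w l * (norm (u l))\<^sup>2)) = (\<Sum>l\<in>V. w l * (norm (u l))\<^sup>2)"
    using assms by (simp add: sum_distrib_left[symmetric] sum_distrib_right[symmetric])
  also have "(\<Sum>j\<in>V. \<Sum>l\<in>V. (w j *\<^sub>R u j) \<bullet> (w l *\<^sub>R u l)) = (norm (\<Sum>j\<in>V. w j *\<^sub>R u j))\<^sup>2"
    by (simp add: power2_norm_eq_inner inner_sum_left inner_sum_right sum_distrib_left mult_ac
        inner_commute)
  finally show ?thesis by argo
qed

lemma norm_convex_combination_le:
  fixes u :: "'i \<Rightarrow> 'a::real_inner"
  assumes "sum w V = 1" "\<And>j. j \<in> V \<Longrightarrow> 0 \<le> w j"
  shows "(norm (\<Sum>j\<in>V. w j *\<^sub>R u j))\<^sup>2 \<le> (\<Sum>j\<in>V. w j * (norm (u j))\<^sup>2)"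
  using assms by (simp add: norm_convex_combination sum_nonneg)

lemma doubly_stochastic_sum:
  fixes w :: "'i \<Rightarrow> 'i \<Rightarrow> real"
  assumes "\<And>j. j \<in> V \<Longrightarrow> (\<Sum>i\<in>V. w i j) = 1"
  shows "(\<Sum>i\<in>V. \<Sum>j\<in>V. w i j * h j) = (\<Sum>j\<in>V. h j)"
  using assms by (subst sum.swap) (simp add: sum_distrib_right[symmetric])

text \<open>The row sums let \<open>z\<close> be moved inside each combination, so the variance
  identity applies to \<open>u j - z\<close> row by row; the column sums then turn the weighted
  squares back into the unmixed sum. The loss does not depend on \<open>z\<close>.\<close>

lemma mixing_identity:
  fixes u :: "'i \<Rightarrow> 'a::real_inner"
  assumes rows: "\<And>i. i \<in> V \<Longrightarrow> (\<Sum>j\<in>V. w i j) = 1"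
    and cols: "\<And>j. j \<in> V \<Longrightarrow> (\<Sum>i\<in>V. w i j) = 1"
  shows "(\<Sum>i\<in>V. (norm ((\<Sum>j\<in>V. w i j *\<^sub>R u j) - z))\<^sup>2) = (\<Sum>j\<in>V. (norm (u j - z))\<^sup>2)
    - (\<Sum>i\<in>V. \<Sum>j\<in>V. \<Sum>l\<in>V. w i j * w i l * (norm (u j - u l))\<^sup>2) / 2"
proof -
  have "(norm ((\<Sum>j\<in>V. w i j *\<^sub>R u j) - z))\<^sup>2 = (\<Sum>j\<in>V. w i j * (norm (u j - z))\<^sup>2)
      - (\<Sum>j\<in>V. \<Sum>l\<in>V. w i j * w i l * (norm (u j - u l))\<^sup>2) / 2" if "i \<in> V" for i
  proof -
    have "(\<Sum>j\<in>V. w i j *\<^sub>R u j) - z = (\<Sum>j\<in>V. w i j *\<^sub>R (u j - z))"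
      using rows[OF that] by (simp add: scaleR_diff_right sum_subtractf scaleR_sum_left[symmetric])
    then show ?thesis
      using norm_convex_combination[OF rows[OF that], of "\<lambda>j. u j - z"] by simp
  qed
  then have "(\<Sum>i\<in>V. (norm ((\<Sum>j\<in>V. w i j *\<^sub>R u j) - z))\<^sup>2) =
      (\<Sum>i\<in>V. \<Sum>j\<in>V. w i j * (norm (u j - z))\<^sup>2)
      - (\<Sum>i\<in>V. (\<Sum>j\<in>V. \<Sum>l\<in>V. w i j * w i l * (norm (u j - u l))\<^sup>2)) / 2"
    by (simp add: sum_subtractf sum_divide_distrib)
  then show ?thesis
    by (simp add: doubly_stochastic_sum[OF cols])
qed

lemma mixing_nonexpansive:
  fixes u :: "'i \<Rightarrow> 'a::real_inner"
  assumes "\<And>i. i \<in> V \<Longrightarrow> (\<Sum>j\<in>V. w i j) = 1" "\<And>j. j \<in> V \<Longrightarrow> (\<Sum>i\<in>V. w i j) = 1"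
    and "\<And>i j. i \<in> V \<Longrightarrow> j \<in> V \<Longrightarrow> 0 \<le> w i j"
  shows "(\<Sum>i\<in>V. (norm ((\<Sum>j\<in>V. w i j *\<^sub>R u j) - z))\<^sup>2) \<le> (\<Sum>j\<in>V. (norm (u j - z))\<^sup>2)"
  using assms by (simp add: mixing_identity sum_nonneg)

definition average :: "'i set \<Rightarrow> ('i \<Rightarrow> 'a::real_vector) \<Rightarrow> 'a" where
  "average V u = (1 / real (card V)) *\<^sub>R (\<Sum>j\<in>V. u j)"

text \<open>Deviations from the mean sum to zero, which kills the cross term when the squares around
  \<open>z\<close> are expanded around the mean.\<close>

lemma average_minimizes:
  fixes u :: "'i \<Rightarrow> 'a::real_inner"
  assumes "finite V" "V \<noteq> {}"
  shows "(\<Sum>j\<in>V. (norm (u j - average V u))\<^sup>2) \<le> (\<Sum>j\<in>V. (norm (u j - z))\<^sup>2)"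
proof -
  let ?a = "average V u"
  have c: "real (card V) > 0" using assms by (simp add: card_gt_0_iff)
  have "(\<Sum>j\<in>V. u j - ?a) = 0"
    using c by (simp add: sum_subtractf average_def sum_constant_scaleR)
  then have "(\<Sum>j\<in>V. (u j - ?a) \<bullet> (?a - z)) = 0"
    by (simp add: inner_sum_left[symmetric])
  moreover have "(norm (u j - z))\<^sup>2 = (norm (u j - ?a))\<^sup>2 + (norm (?a - z))\<^sup>2 + 2 * ((u j - ?a) \<bullet> (?a - z))" for j
    by (simp add: power2_norm_eq_inner inner_diff inner_commute algebra_simps)
  ultimately have "(\<Sum>j\<in>V. (norm (u j - z))\<^sup>2) = (\<Sum>j\<in>V. (norm (u j - ?a))\<^sup>2) + (\<Sum>j\<in>V. (norm (?a - z))\<^sup>2)"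
    by (simp add: sum.distrib sum_distrib_left[symmetric])
  then show ?thesis by (simp add: sum_nonneg)
qed

lemma norm_diff_average_le:
  fixes u :: "'i \<Rightarrow> 'a::real_normed_vector"
  assumes "finite V" "a \<in> V" "\<And>b. b \<in> V \<Longrightarrow> norm (u a - u b) \<le> r"
  shows "norm (u a - average V u) \<le> r"
proof -
  have c: "real (card V) > 0" using assms by (auto simp: card_gt_0_iff)
  have "u a - average V u = (1 / real (card V)) *\<^sub>R (\<Sum>b\<in>V. u a - u b)"
    using c by (simp add: sum_subtractf average_def sum_constant_scaleR algebra_simps)
  also have "norm \<dots> \<le> (1 / real (card V)) * (\<Sum>b\<in>V. r)"
    unfolding norm_scaleR using assms
    by (intro mult_mono order.trans[OF norm_sum] sum_mono) (auto intro: sum_nonneg order.trans)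
  finally show ?thesis using c by simp
qed

lemma relpow_norm_diff_le:
  fixes u :: "'i \<Rightarrow> 'a::real_normed_vector"
  assumes "\<And>a b. (a, b) \<in> E \<Longrightarrow> norm (u a - u b) \<le> r"
  shows "(a, b) \<in> E ^^ n \<Longrightarrow> norm (u a - u b) \<le> real n * r"
proof (induction n arbitrary: b)
  case (Suc n)
  then obtain c where "(a, c) \<in> E ^^ n" "(c, b) \<in> E" by auto
  then have "norm (u a - u c) \<le> real n * r" "norm (u c - u b) \<le> r"
    using Suc.IH assms by auto
  then show ?case
    using norm_triangle_ineq[of "u a - u c" "u c - u b"] by (simp add: algebra_simps)
qed simp

text \<open>A small loss \<open>D\<close> in the mixing identity forces small differences along
  edges and hence, along paths, between all users: edges differ by at most \<open>r\<close>,
  arbitrary pairs by at most \<open>N\<^sup>2 * r\<close>, and so the disagreement is at most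
  \<open>N ^ 5 * (2 * D / w0\<^sup>2)\<close>. Solving for \<open>D\<close> gives the contraction
  factor.\<close>

lemma mixing_contraction:
  fixes u :: "'i \<Rightarrow> 'a::real_inner"
  assumes V: "finite V" "V \<noteq> {}"
    and rows: "\<And>i. i \<in> V \<Longrightarrow> (\<Sum>j\<in>V. w i j) = 1"
    and cols: "\<And>j. j \<in> V \<Longrightarrow> (\<Sum>i\<in>V. w i j) = 1"
    and nonneg: "\<And>i j. i \<in> V \<Longrightarrow> j \<in> V \<Longrightarrow> 0 \<le> w i j"
    and E: "E \<subseteq> V \<times> V" "V \<times> V \<subseteq> E\<^sup>*"
    and w0: "0 < w0" "\<And>i. i \<in> V \<Longrightarrow> w0 \<le> w i i" "\<And>i j. (i, j) \<in> E \<Longrightarrow> w0 \<le> w i j"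
  shows "(\<Sum>i\<in>V. (norm ((\<Sum>j\<in>V. w i j *\<^sub>R u j) - average V u))\<^sup>2)
    \<le> (1 - w0\<^sup>2 / (2 * real (card V) ^ 5)) * (\<Sum>j\<in>V. (norm (u j - average V u))\<^sup>2)"
proof -
  define N where "N = real (card V)"
  have N: "N > 0" using V by (simp add: N_def card_gt_0_iff)
  define D where "D = (\<Sum>i\<in>V. \<Sum>j\<in>V. \<Sum>l\<in>V. w i j * w i l * (norm (u j - u l))\<^sup>2) / 2"
  have D0: "D \<ge> 0" unfolding D_def using nonneg by (simp add: sum_nonneg)
  define r where "r = sqrt (2 * D) / w0"
  have r0: "r \<ge> 0" using D0 w0 by (simp add: r_def)
  \<comment> \<open>Because of the self-loop at \<open>i\<close>, the loss \<open>D\<close> contains the term \<open>w i i * w i j\<close>.\<close>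
  have edge: "norm (u i - u j) \<le> r" if e: "(i, j) \<in> E" for i j
  proof -
    have ij: "i \<in> V" "j \<in> V" using e E by auto
    have nn: "0 \<le> w i' j' * w i' l * (norm (u j' - u l))\<^sup>2" if "i' \<in> V" "j' \<in> V" "l \<in> V" for i' j' l
      using nonneg that by simp
    have "w0\<^sup>2 * (norm (u i - u j))\<^sup>2 \<le> w i i * w i j * (norm (u i - u j))\<^sup>2"
      unfolding power2_eq_square[of w0]
      using w0 e ij by (intro mult_right_mono mult_mono) (auto intro: nonneg)
    also have "\<dots> \<le> (\<Sum>l\<in>V. w i i * w i l * (norm (u i - u l))\<^sup>2)"
      using V ij nn by (intro member_le_sum) auto
    also have "\<dots> \<le> (\<Sum>j\<in>V. \<Sum>l\<in>V. w i j * w i l * (norm (u j - u l))\<^sup>2)"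
      using V ij nn by (intro member_le_sum[where f = "\<lambda>j. \<Sum>l\<in>V. w i j * w i l * (norm (u j - u l))\<^sup>2"] sum_nonneg) auto
    also have "\<dots> \<le> (\<Sum>i\<in>V. \<Sum>j\<in>V. \<Sum>l\<in>V. w i j * w i l * (norm (u j - u l))\<^sup>2)"
      using V ij nn by (intro member_le_sum[where f = "\<lambda>i. \<Sum>j\<in>V. \<Sum>l\<in>V. w i j * w i l * (norm (u j - u l))\<^sup>2"] sum_nonneg) auto
    finally have "(w0 * norm (u i - u j))\<^sup>2 \<le> 2 * D"
      by (simp add: D_def power_mult_distrib)
    then have "w0 * norm (u i - u j) \<le> sqrt (2 * D)"
      by (simp add: real_le_rsqrt)
    then show ?thesis using w0 by (simp add: r_def field_simps)
  qed
  have finE: "finite E" using E V by (meson finite_SigmaI finite_subset)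
  have "card E \<le> card (V \<times> V)" using E V by (intro card_mono) auto
  then have cE: "real (card E) \<le> N\<^sup>2"
    by (simp add: N_def card_cartesian_product power2_eq_square flip: of_nat_mult)
  have pair: "norm (u a - u b) \<le> N\<^sup>2 * r" if "a \<in> V" "b \<in> V" for a b
  proof -
    have "(a, b) \<in> E\<^sup>*" using that E by auto
    \<comment> \<open>In a finite relation a walk can be shortened to at most \<open>card E\<close>
      steps, and \<open>card E\<close> is at most \<open>N\<^sup>2\<close>.\<close>
    then obtain n where n: "n \<le> card E" "(a, b) \<in> E ^^ n"
      by (auto simp: rtrancl_finite_eq_relpow[OF finE])
    have "norm (u a - u b) \<le> real n * r"
      using relpow_norm_diff_le[OF edge n(2)] .
    also have "\<dots> \<le> N\<^sup>2 * r"
      using n cE r0 by (intro mult_right_mono) auto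
    finally show ?thesis .
  qed
  have "(\<Sum>j\<in>V. (norm (u j - average V u))\<^sup>2) \<le> (\<Sum>j\<in>V. (N\<^sup>2 * r)\<^sup>2)"
    using V pair by (intro sum_mono power_mono norm_diff_average_le) auto
  also have "\<dots> = N ^ 5 * (2 * D / w0\<^sup>2)"
    using D0 by (simp add: N_def r_def power_mult_distrib power_divide eval_nat_numeral)
  finally have "w0\<^sup>2 / (2 * N ^ 5) * (\<Sum>j\<in>V. (norm (u j - average V u))\<^sup>2)
      \<le> w0\<^sup>2 / (2 * N ^ 5) * (N ^ 5 * (2 * D / w0\<^sup>2))"
    using w0 N by (intro mult_left_mono) auto
  also have "\<dots> = D" using w0 N by (simp add: field_simps)
  finally show ?thesis
    using mixing_identity[OF rows cols, where u = u and z = "average V u"]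
    by (simp add: N_def D_def algebra_simps)
qed

section \<open>Almost decreasing sequences\<close>

lemma summable_partial_sums_le:
  fixes b :: "nat \<Rightarrow> real"
  assumes "summable b"
  obtains B where "\<And>n. (\<Sum>k<n. b k) \<le> B"
proof -
  have "Bseq (\<lambda>n. \<Sum>k<n. b k)"
    using assms by (simp add: summable_iff_convergent convergent_imp_Bseq)
  then obtain B where "\<And>n. norm (\<Sum>k<n. b k) \<le> B" by (auto simp: Bseq_def)
  then show ?thesis by (intro that[of B]) (auto intro: order.trans[OF abs_ge_self])
qed

text \<open>Telescoping bounds the partial sums of \<open>u\<close> by \<open>a 0\<close> plus a
  bound for the partial sums of \<open>b\<close>. The same argument serves for the disagreement, for
  the optimality gaps and for the expected squared distances.\<close>

lemma almost_decreasing_summable: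
  fixes a b u :: "nat \<Rightarrow> real"
  assumes a: "\<And>k. 0 \<le> a k" and u: "\<And>k. 0 \<le> u k"
    and step: "\<And>k. a (Suc k) + u k \<le> a k + b k" and b: "summable b"
  shows "summable u"
proof -
  obtain B where B: "\<And>n. (\<Sum>k<n. b k) \<le> B"
    using summable_partial_sums_le[OF b] by blast
  have "a n + (\<Sum>k<n. u k) \<le> a 0 + (\<Sum>k<n. b k)" for n
  proof (induction n)
    case (Suc n)
    then show ?case using step[of n] by simp
  qed simp
  then have "(\<Sum>k<n. u k) \<le> a 0 + B" for n
    using a[of n] B[of n] by (smt (verit))
  then show ?thesis by (intro bounded_imp_summable[of u "a 0 + B"] u) (metis lessThan_Suc_atMost)
qed

text \<open>Subtracting the partial sums of \<open>b\<close> leaves a decreasing sequence, bounded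
  below because \<open>a\<close> is nonnegative and these partial sums are bounded above.\<close>

lemma almost_decreasing_convergent:
  fixes a b :: "nat \<Rightarrow> real"
  assumes a: "\<And>k. 0 \<le> a k" and step: "\<And>k. a (Suc k) \<le> a k + b k" and b: "summable b"
  shows "convergent a"
proof -
  define c where "c n = a n - (\<Sum>k<n. b k)" for n
  obtain B where B: "\<And>n. (\<Sum>k<n. b k) \<le> B"
    using summable_partial_sums_le[OF b] by blast
  have "decseq c" using step by (auto simp: decseq_Suc_iff c_def algebra_simps)
  moreover have "c n \<ge> - B" for n using a[of n] B[of n] by (simp add: c_def)
  ultimately have "convergent c" using decseq_convergent[of c "- B"] convergentI by blast
  moreover have "convergent (\<lambda>n. \<Sum>k<n. b k)" using b by (simp add: summable_iff_convergent)
  ultimately have "convergent (\<lambda>n. c n + (\<Sum>k<n. b k))" by (rule convergent_add)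
  then show ?thesis by (simp add: c_def)
qed

text \<open>Were \<open>h\<close> at least \<open>e\<close> from \<open>K\<close> on, the tail of
  \<open>\<alpha>\<close> would be dominated by \<open>(1 / e) * (\<alpha> k * h k)\<close> and
  hence summable, against the divergence of its partial sums.\<close>

lemma frequently_small_of_weighted_summable:
  fixes \<alpha> h :: "nat \<Rightarrow> real"
  assumes "\<And>k. 0 < \<alpha> k" "filterlim (\<lambda>K. \<Sum>k<K. \<alpha> k) at_top sequentially"
    and s: "summable (\<lambda>k. \<alpha> k * h k)" and e: "e > 0"
  shows "\<exists>k\<ge>K. h k < e"
proof (rule ccontr)
  assume "\<not> ?thesis"
  then have h: "h k \<ge> e" if "k \<ge> K" for k using that by force
  have "summable \<alpha>"
  proof (rule summable_comparison_test_ev)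
    show "\<forall>\<^sub>F k in sequentially. norm (\<alpha> k) \<le> (1 / e) * (\<alpha> k * h k)"
      using eventually_ge_at_top[of K]
    proof eventually_elim
      case (elim k)
      have "\<alpha> k * e \<le> \<alpha> k * h k" using assms(1)[of k] h[OF elim] by (intro mult_left_mono) auto
      then show ?case using e assms(1)[of k] by (simp add: field_simps)
    qed
    show "summable (\<lambda>k. (1 / e) * (\<alpha> k * h k))" by (rule summable_mult[OF s])
  qed
  then have "(\<lambda>K. \<Sum>k<K. \<alpha> k) \<longlonglongrightarrow> suminf \<alpha>" by (rule summable_LIMSEQ)
  then show False
    using assms(2) not_tendsto_and_filterlim_at_infinity[OF trivial_limit_sequentially]
      filterlim_at_top_imp_at_infinity by blast
qed

section \<open>Subgradients and projections\<close>

text \<open>The point \<open>(p, h p)\<close> lies outside the convex strict epigraph, so a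
  hyperplane with some normal \<open>(a, b)\<close> separates them. It is not vertical because
  \<open>h\<close> is finite everywhere, and dividing by \<open>b > 0\<close> yields the subgradient
  \<open>- (1 / b) *\<^sub>R a\<close>. Existence is what turns bounds on subgradients into bounds
  on differences of function values.\<close>

lemma subdifferential_nonempty:
  fixes h :: "'a::euclidean_space \<Rightarrow> real"
  assumes "convex_on UNIV h"
  shows "subdifferential h p \<noteq> {}"
proof -
  define T where "T = {(y, t). h y < t}"
  have "convex T"
    unfolding convex_def T_def
  proof (clarsimp)
    fix y t y' t' u v :: real and y1 y2 :: 'a
    assume *: "h y1 < t" "h y2 < t'" "0 \<le> u" "0 \<le> v" "u + v = 1"
    have "h (u *\<^sub>R y1 + v *\<^sub>R y2) \<le> u * h y1 + v * h y2"
      using assms * by (auto simp: convex_on_def)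
    also have "\<dots> < u * t + v * t'"
    proof (cases "u = 0")
      case False
      then have "u * h y1 < u * t" "v * h y2 \<le> v * t'" using * by (auto intro: mult_left_mono)
      then show ?thesis by simp
    qed (use * in auto)
    finally show "h (u *\<^sub>R y1 + v *\<^sub>R y2) < u * t + v * t'" .
  qed
  moreover have "(p, h p + 1) \<in> T" "(p, h p) \<notin> T" by (auto simp: T_def)
  ultimately have "\<exists>ab c. ab \<noteq> 0 \<and> (\<forall>q\<in>{(p, h p)}. ab \<bullet> q \<le> c) \<and> (\<forall>q\<in>T. c \<le> ab \<bullet> q)"
    by (intro separating_hyperplane_sets) auto
  then obtain ab c where ab: "ab \<noteq> 0" "ab \<bullet> (p, h p) \<le> c" "\<And>q. q \<in> T \<Longrightarrow> c \<le> ab \<bullet> q"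
    by (metis singletonI)
  obtain a b where [simp]: "ab = (a, b)" by (cases ab)
  have *: "a \<bullet> p + b * h p \<le> a \<bullet> y + b * t" if "h y < t" for y t
    using ab(2) ab(3)[of "(y, t)"] that by (auto simp: T_def)
  have "b \<ge> 0" using *[of p "h p + 1"] by (simp add: algebra_simps)
  moreover have "b \<noteq> 0"
  proof
    assume b: "b = 0"
    \<comment> \<open>With \<open>b = 0\<close> the inner product with \<open>a\<close> would be
      minimal at \<open>p\<close> over the whole space; testing it at \<open>p - a\<close> forces
      \<open>a = 0\<close>.\<close>
    have "a \<bullet> p \<le> a \<bullet> (p - a)" using *[of "p - a" "h (p - a) + 1"] b by simp
    then have "a \<bullet> a \<le> 0" by (simp add: inner_diff_right)
    then have "a = 0" by (metis inner_eq_zero_iff inner_ge_zero order_antisym)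
    with b ab(1) show False by (simp add: zero_prod_def)
  qed
  ultimately have b: "b > 0" by simp
  have "h y \<ge> h p + (- (1 / b) *\<^sub>R a) \<bullet> (y - p)" for y
  \<comment> \<open>The strict epigraph contains only heights above \<open>h y\<close>, so the
    inequality is obtained up to every \<open>e > 0\<close>.\<close>
  proof (rule field_le_epsilon)
    fix e :: real assume "e > 0"
    then have "a \<bullet> p + b * h p \<le> a \<bullet> y + b * (h y + e)" using *[of y "h y + e"] by simp
    then have "b * (h p + (- (1 / b) *\<^sub>R a) \<bullet> (y - p)) \<le> b * (h y + e)"
      using b by (simp add: algebra_simps)
    then show "h p + (- (1 / b) *\<^sub>R a) \<bullet> (y - p) \<le> h y + e" using b by simp
  qed
  then show ?thesis unfolding subdifferential_def by blast
qed

lemma infdist_closest_point: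
  fixes S :: "'a::euclidean_space set"
  assumes "closed S" "S \<noteq> {}"
  shows "infdist a S = norm (a - closest_point S a)"
  using assms by (simp add: infdist_eq_setdist setdist_closest_point dist_norm)

text \<open>The angle at the projection between the directions to \<open>a\<close> and to
  \<open>z\<close> is not acute, so expanding the square of \<open>a - z\<close> around the
  projection leaves a cross term of favourable sign.\<close>

lemma closest_point_pythagoras:
  fixes S :: "'a::euclidean_space set"
  assumes "closed S" "convex S" "z \<in> S"
  shows "(norm (closest_point S a - z))\<^sup>2 + (infdist a S)\<^sup>2 \<le> (norm (a - z))\<^sup>2"
proof -
  let ?p = "closest_point S a"
  have "(a - ?p) \<bullet> (z - ?p) \<le> 0" using closest_point_dot assms by blast
  moreover have "(norm (a - z))\<^sup>2 = (norm (?p - z))\<^sup>2 + (norm (a - ?p))\<^sup>2 - 2 * ((a - ?p) \<bullet> (z - ?p))"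
    by (simp add: power2_norm_eq_inner inner_diff inner_commute)
  moreover have "infdist a S = norm (a - ?p)" using assms by (intro infdist_closest_point) auto
  ultimately show ?thesis by simp
qed

text \<open>The same combination of the projections of the \<open>u j\<close> lies in
  \<open>X\<close> and serves as a competitor; convexity of the squared norm and the column sums do
  the rest.\<close>

lemma mixing_infdist:
  fixes u :: "'i \<Rightarrow> 'a::euclidean_space"
  assumes X: "closed X" "convex X" "X \<noteq> {}"
    and V: "finite V"
    and rows: "\<And>i. i \<in> V \<Longrightarrow> (\<Sum>j\<in>V. w i j) = 1"
    and cols: "\<And>j. j \<in> V \<Longrightarrow> (\<Sum>i\<in>V. w i j) = 1"
    and nonneg: "\<And>i j. i \<in> V \<Longrightarrow> j \<in> V \<Longrightarrow> 0 \<le> w i j"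
  shows "(\<Sum>i\<in>V. (infdist (\<Sum>j\<in>V. w i j *\<^sub>R u j) X)\<^sup>2) \<le> (\<Sum>j\<in>V. (infdist (u j) X)\<^sup>2)"
proof -
  let ?p = "\<lambda>j. closest_point X (u j)"
  have "(infdist (\<Sum>j\<in>V. w i j *\<^sub>R u j) X)\<^sup>2 \<le> (\<Sum>j\<in>V. w i j * (infdist (u j) X)\<^sup>2)" if i: "i \<in> V" for i
  proof -
    have "(\<Sum>j\<in>V. w i j *\<^sub>R ?p j) \<in> X"
      using X V rows i nonneg by (intro convex_sum closest_point_in_set) auto
    then have "infdist (\<Sum>j\<in>V. w i j *\<^sub>R u j) X \<le> norm ((\<Sum>j\<in>V. w i j *\<^sub>R u j) - (\<Sum>j\<in>V. w i j *\<^sub>R ?p j))"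
      using infdist_le by (metis dist_norm)
    also have "\<dots> = norm (\<Sum>j\<in>V. w i j *\<^sub>R (u j - ?p j))"
      by (simp add: scaleR_diff_right sum_subtractf)
    finally have "(infdist (\<Sum>j\<in>V. w i j *\<^sub>R u j) X)\<^sup>2 \<le> (norm (\<Sum>j\<in>V. w i j *\<^sub>R (u j - ?p j)))\<^sup>2"
      by (simp add: power_mono infdist_nonneg)
    also have "\<dots> \<le> (\<Sum>j\<in>V. w i j * (norm (u j - ?p j))\<^sup>2)"
      using rows i nonneg by (intro norm_convex_combination_le) auto
    finally show ?thesis using X by (simp add: infdist_closest_point)
  qed
  then have "(\<Sum>i\<in>V. (infdist (\<Sum>j\<in>V. w i j *\<^sub>R u j) X)\<^sup>2) \<le> (\<Sum>i\<in>V. \<Sum>j\<in>V. w i j * (infdist (u j) X)\<^sup>2)"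
    by (rule sum_mono)
  then show ?thesis by (simp add: doubly_stochastic_sum[OF cols])
qed

text \<open>Expand the square after the subgradient step, then apply the Pythagorean inequality for
  \<open>S\<close>. The distance removed by the projection is kept on the left, since it is the
  source of the decrease of the distance to \<open>X\<close>.\<close>

lemma projected_step:
  fixes S :: "'a::euclidean_space set"
  assumes S: "closed S" "convex S" "z \<in> S" and g: "norm g \<le> C"
  shows "(norm (closest_point S (v - a *\<^sub>R g) - z))\<^sup>2 + (infdist (v - a *\<^sub>R g) S)\<^sup>2
    \<le> (norm (v - z))\<^sup>2 - 2 * a * (g \<bullet> (v - z)) + a\<^sup>2 * C\<^sup>2"
proof -
  have "(norm (v - a *\<^sub>R g - z))\<^sup>2 = (norm (v - z))\<^sup>2 - 2 * a * (g \<bullet> (v - z)) + a\<^sup>2 * (norm g)\<^sup>2"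
    by (simp only: power2_norm_eq_inner)
      (simp add: inner_diff inner_commute algebra_simps power2_eq_square)
  moreover have "a\<^sup>2 * (norm g)\<^sup>2 \<le> a\<^sup>2 * C\<^sup>2"
    using g by (intro mult_left_mono power_mono) auto
  ultimately show ?thesis using closest_point_pythagoras[OF S, of "v - a *\<^sub>R g"] by linarith
qed

text \<open>Young's inequality, from the square \<open>(e * a - b)\<^sup>2\<close>.\<close>

lemma two_mult_le_squares:
  fixes a b e :: real
  assumes "e > 0"
  shows "2 * (a * b) \<le> e * a\<^sup>2 + b\<^sup>2 / e"
proof -
  have "0 \<le> (e * a - b)\<^sup>2 / e" using assms by simp
  then show ?thesis using assms by (simp add: power2_eq_square field_simps)
qed

lemma power2_sum_le:
  fixes a b e :: real
  assumes "e > 0"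
  shows "(a + b)\<^sup>2 \<le> (1 + e) * a\<^sup>2 + (1 + 1 / e) * b\<^sup>2"
  using two_mult_le_squares[OF assms, of a b] by (simp add: power2_sum algebra_simps)

text \<open>The projection of \<open>v\<close> onto \<open>X\<close> is a point of \<open>S\<close>,
  so the step estimate applies with it in the role of \<open>z\<close>. Young's inequality absorbs
  the inner product; its parameter \<open>e\<close> stays free so that the growth can later be made
  small compared with the expected gain. Passing from the distance of the shifted point to that of
  \<open>v\<close> costs the factor 1/2 and another \<open>(a * C)\<^sup>2\<close>.\<close>

lemma projected_step_infdist:
  fixes S :: "'a::euclidean_space set"
  assumes X: "closed X" "convex X" "X \<noteq> {}" and S: "closed S" "convex S" "X \<subseteq> S"
    and g: "norm g \<le> C" and e: "e > 0" and a: "a \<ge> 0"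
  shows "(infdist (closest_point S (v - a *\<^sub>R g)) X)\<^sup>2 + (infdist v S)\<^sup>2 / 2
    \<le> (1 + e) * (infdist v X)\<^sup>2 + (1 / e + 2) * C\<^sup>2 * a\<^sup>2"
proof -
  let ?y = "v - a *\<^sub>R g" and ?p = "closest_point X v"
  have C: "C \<ge> 0" using g norm_ge_zero order_trans by blast
  have p: "?p \<in> X" using X closest_point_in_set by blast
  have d: "infdist v X = norm (v - ?p)" using X by (intro infdist_closest_point)
  have "(infdist (closest_point S ?y) X)\<^sup>2 \<le> (norm (closest_point S ?y - ?p))\<^sup>2"
    using infdist_le[OF p] by (simp add: dist_norm power_mono infdist_nonneg)
  moreover have "(norm (closest_point S ?y - ?p))\<^sup>2 + (infdist ?y S)\<^sup>2
      \<le> (norm (v - ?p))\<^sup>2 - 2 * a * (g \<bullet> (v - ?p)) + a\<^sup>2 * C\<^sup>2"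
    using p S g by (intro projected_step) auto
  moreover have "- (2 * a * (g \<bullet> (v - ?p))) \<le> 2 * (norm (v - ?p) * (a * C))"
  proof -
    have "- (g \<bullet> (v - ?p)) \<le> norm g * norm (v - ?p)"
      using Cauchy_Schwarz_ineq2[of g "v - ?p"] by linarith
    also have "\<dots> \<le> C * norm (v - ?p)" using g by (intro mult_right_mono) auto
    finally have "2 * a * (- (g \<bullet> (v - ?p))) \<le> 2 * a * (C * norm (v - ?p))"
      using a by (intro mult_left_mono) auto
    moreover have "- (2 * a * t) \<le> 2 * (n * (a * C))" if "2 * a * (- t) \<le> 2 * a * (C * n)" for t n
      using that by (simp add: mult_ac)
    ultimately show ?thesis by blast
  qed
  moreover have "2 * (norm (v - ?p) * (a * C)) \<le> e * (norm (v - ?p))\<^sup>2 + (a * C)\<^sup>2 / e"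
    using e by (rule two_mult_le_squares)
  moreover have "(infdist v S)\<^sup>2 \<le> 2 * (infdist ?y S)\<^sup>2 + 2 * (a * C)\<^sup>2"
  proof -
    have "infdist v S \<le> infdist ?y S + dist v ?y" by (rule infdist_triangle)
    moreover have "dist v ?y \<le> a * C" using a g by (simp add: dist_norm mult_left_mono)
    ultimately have "(infdist v S)\<^sup>2 \<le> (infdist ?y S + a * C)\<^sup>2"
      by (intro power_mono) (auto simp: infdist_nonneg)
    then show ?thesis using power2_sum_le[of 1 "infdist ?y S" "a * C"] by simp
  qed
  ultimately have "(infdist (closest_point S ?y) X)\<^sup>2 + (infdist v S)\<^sup>2 / 2
      \<le> (infdist v X)\<^sup>2 + e * (infdist v X)\<^sup>2 + (a * C)\<^sup>2 / e + a\<^sup>2 * C\<^sup>2 + (a * C)\<^sup>2"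
    unfolding d by linarith
  then show ?thesis by (simp add: power_mult_distrib algebra_simps)
qed

text \<open>The projection of \<open>v\<close> onto \<open>X\<close> is fixed by the nonexpansive
  projection onto \<open>S\<close>, so the new point and \<open>v\<close> are both close to it. The
  displacement is at most \<open>2 * infdist v X + a * C\<close>.\<close>

lemma projected_step_displacement:
  fixes S :: "'a::euclidean_space set"
  assumes X: "closed X" "X \<noteq> {}" and S: "closed S" "convex S" "X \<subseteq> S"
    and g: "norm g \<le> C" and a: "a \<ge> 0"
  shows "(norm (closest_point S (v - a *\<^sub>R g) - v))\<^sup>2 \<le> 8 * (infdist v X)\<^sup>2 + 2 * C\<^sup>2 * a\<^sup>2"
proof -
  let ?y = "v - a *\<^sub>R g" and ?p = "closest_point X v"
  have p: "?p \<in> S" using X S closest_point_in_set by blast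
  have d: "infdist v X = norm (v - ?p)" using X by (intro infdist_closest_point)
  have "norm (closest_point S ?y - v) \<le> norm (closest_point S ?y - ?p) + norm (?p - v)"
    using norm_triangle_ineq[of "closest_point S ?y - ?p" "?p - v"] by simp
  also have "norm (closest_point S ?y - ?p) \<le> norm (?y - ?p)"
    using closest_point_lipschitz[of S ?y ?p] p S by (auto simp: dist_norm closest_point_self)
  also have "norm (?y - ?p) \<le> norm (v - ?p) + norm (a *\<^sub>R g)"
    using norm_triangle_ineq4[of "v - ?p" "a *\<^sub>R g"] by (simp add: algebra_simps)
  also have "norm (a *\<^sub>R g) \<le> a * C" using a g by (simp add: mult_left_mono)
  finally have "norm (closest_point S ?y - v) \<le> 2 * infdist v X + a * C"
    by (simp add: d norm_minus_commute)
  then have "(norm (closest_point S ?y - v))\<^sup>2 \<le> (2 * infdist v X + a * C)\<^sup>2"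
    by (intro power_mono) auto
  also have "\<dots> \<le> 2 * (2 * infdist v X)\<^sup>2 + 2 * (a * C)\<^sup>2"
    using power2_sum_le[of 1 "2 * infdist v X" "a * C"] by simp
  finally show ?thesis by (simp add: power_mult_distrib mult_ac)
qed

section \<open>Deterministic convergence\<close>

text \<open>Connectivity is encoded as reachability in each single graph, the form in which the
  contraction estimate uses it. The condition on windows supplies it, since the intersection over a
  window is contained in its first graph.\<close>

locale consensus_network =
  fixes V :: "'i set" and E :: "nat \<Rightarrow> ('i \<times> 'i) set" and w :: "'i \<Rightarrow> 'i \<Rightarrow> nat \<Rightarrow> real" and w0 :: real
  assumes V: "finite V" "V \<noteq> {}"
    and rows: "\<And>i k. i \<in> V \<Longrightarrow> (\<Sum>j\<in>V. w i j k) = 1"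
    and cols: "\<And>j k. j \<in> V \<Longrightarrow> (\<Sum>i\<in>V. w i j k) = 1"
    and nonneg: "\<And>i j k. i \<in> V \<Longrightarrow> j \<in> V \<Longrightarrow> 0 \<le> w i j k"
    and E: "\<And>k. E k \<subseteq> V \<times> V" "\<And>k. V \<times> V \<subseteq> (E k)\<^sup>*"
    and w0: "0 < w0" "\<And>i k. i \<in> V \<Longrightarrow> w0 \<le> w i i k" "\<And>i j k. (i, j) \<in> E k \<Longrightarrow> w0 \<le> w i j k"
begin

text \<open>The move from \<open>v i k\<close> to \<open>x i (Suc k)\<close> is treated as a
  perturbation. Mixing contracts by \<open>1 - q\<close>, splitting off the perturbation costs a
  factor \<open>1 + q / 2\<close>, and the product is at most \<open>1 - q / 2\<close>.\<close>

lemma consensus: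
  fixes x v :: "'i \<Rightarrow> nat \<Rightarrow> 'a::real_inner"
  assumes v: "\<And>i k. i \<in> V \<Longrightarrow> v i k = (\<Sum>j\<in>V. w i j k *\<^sub>R x j k)"
    and e: "summable (\<lambda>k. \<Sum>i\<in>V. (norm (x i (Suc k) - v i k))\<^sup>2)"
  shows "summable (\<lambda>k. \<Sum>i\<in>V. (norm (x i k - average V (\<lambda>j. x j k)))\<^sup>2)"
proof -
  define A where "A k = (\<Sum>i\<in>V. (norm (x i k - average V (\<lambda>j. x j k)))\<^sup>2)" for k
  have A0: "A k \<ge> 0" for k by (simp add: A_def sum_nonneg)
  define q where "q = w0\<^sup>2 / (2 * real (card V) ^ 5)"
  have q: "q > 0" using V w0 by (simp add: q_def card_gt_0_iff)
  have "A (Suc k) + q / 2 * A k \<le> A k + (1 + 2 / q) * (\<Sum>i\<in>V. (norm (x i (Suc k) - v i k))\<^sup>2)" for k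
  proof -
    let ?m = "average V (\<lambda>j. x j k)"
    \<comment> \<open>Measuring from the old mean instead of the new one can only increase the sum,
      and the old mean is the centre around which mixing contracts.\<close>
    have "A (Suc k) \<le> (\<Sum>i\<in>V. (norm (x i (Suc k) - ?m))\<^sup>2)"
      unfolding A_def by (rule average_minimizes[OF V])
    also have "\<dots> \<le> (\<Sum>i\<in>V. (1 + q / 2) * (norm (v i k - ?m))\<^sup>2 + (1 + 2 / q) * (norm (x i (Suc k) - v i k))\<^sup>2)"
    proof (rule sum_mono)
      fix i assume "i \<in> V"
      have "norm (x i (Suc k) - ?m) \<le> norm (v i k - ?m) + norm (x i (Suc k) - v i k)"
        using norm_triangle_ineq[of "v i k - ?m" "x i (Suc k) - v i k"] by simp
      then have "(norm (x i (Suc k) - ?m))\<^sup>2 \<le> (norm (v i k - ?m) + norm (x i (Suc k) - v i k))\<^sup>2"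
        by (intro power_mono) auto
      also have "\<dots> \<le> (1 + q / 2) * (norm (v i k - ?m))\<^sup>2 + (1 + 1 / (q / 2)) * (norm (x i (Suc k) - v i k))\<^sup>2"
        using q by (intro power2_sum_le) auto
      finally show "(norm (x i (Suc k) - ?m))\<^sup>2 \<le>
          (1 + q / 2) * (norm (v i k - ?m))\<^sup>2 + (1 + 2 / q) * (norm (x i (Suc k) - v i k))\<^sup>2" by simp
    qed
    also have "\<dots> = (1 + q / 2) * (\<Sum>i\<in>V. (norm (v i k - ?m))\<^sup>2)
        + (1 + 2 / q) * (\<Sum>i\<in>V. (norm (x i (Suc k) - v i k))\<^sup>2)"
      by (simp add: sum.distrib sum_distrib_left)
    finally have 1: "A (Suc k) \<le> (1 + q / 2) * (\<Sum>i\<in>V. (norm (v i k - ?m))\<^sup>2)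
        + (1 + 2 / q) * (\<Sum>i\<in>V. (norm (x i (Suc k) - v i k))\<^sup>2)" .
    have "(\<Sum>i\<in>V. (norm (v i k - ?m))\<^sup>2) \<le> (1 - q) * A k"
      using mixing_contraction[OF V rows[of _ k] cols[of _ k] nonneg[of _ _ k] E[of k]
          w0(1) w0(2)[of _ k] w0(3)[of _ _ k], where u = "\<lambda>j. x j k"]
      by (simp add: v q_def A_def)
    then have "(1 + q / 2) * (\<Sum>i\<in>V. (norm (v i k - ?m))\<^sup>2) \<le> (1 + q / 2) * ((1 - q) * A k)"
      using q by (intro mult_left_mono) auto
    also have "\<dots> = (1 - q / 2 - q\<^sup>2 / 2) * A k"
      by (simp add: algebra_simps power2_eq_square)
    also have "\<dots> \<le> (1 - q / 2) * A k"
      using A0 by (intro mult_right_mono) auto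
    also have "\<dots> = A k - q / 2 * A k" by (simp add: algebra_simps)
    finally show ?thesis using 1 by linarith
  qed
  from almost_decreasing_summable[OF A0 _ this summable_mult[OF e]] A0 q
  have "summable (\<lambda>k. q / 2 * A k)" by simp
  then have "summable A" using q by (simp add: summable_cmult_iff)
  then show ?thesis by (simp add: A_def[abs_def])
qed

text \<open>One fixed trajectory is considered, with the outcome of the draws recorded in the sets
  \<open>S i k\<close>. The pattern is Opial's: the distances to every point of \<open>Z\<close>
  converge in the aggregate \<open>a z\<close>, and an accumulation point in \<open>Z\<close> can
  itself be taken as reference point, which forces its limit to be zero.\<close>

lemma trajectory_convergence:
  fixes x v g :: "'i \<Rightarrow> nat \<Rightarrow> 'a::euclidean_space" and f :: "'i \<Rightarrow> 'a \<Rightarrow> real"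
    and X :: "'a set" and S :: "'i \<Rightarrow> nat \<Rightarrow> 'a set" and \<alpha> :: "nat \<Rightarrow> real" and B C :: real
  defines "F \<equiv> \<lambda>y. \<Sum>i\<in>V. f i y"
  defines "Z \<equiv> {z \<in> X. \<forall>y\<in>X. F z \<le> F y}"
  assumes X: "closed X" "convex X"
    and S: "\<And>i k. i \<in> V \<Longrightarrow> closed (S i k)" "\<And>i k. i \<in> V \<Longrightarrow> convex (S i k)"
      "\<And>i k. i \<in> V \<Longrightarrow> X \<subseteq> S i k"
    and v: "\<And>i k. i \<in> V \<Longrightarrow> v i k = (\<Sum>j\<in>V. w i j k *\<^sub>R x j k)"
    and step: "\<And>i k. i \<in> V \<Longrightarrow> x i (Suc k) = closest_point (S i k) (v i k - \<alpha> k *\<^sub>R g i k)"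
    and g: "\<And>i k. i \<in> V \<Longrightarrow> g i k \<in> subdifferential (f i) (v i k)"
      "\<And>i k. i \<in> V \<Longrightarrow> norm (g i k) \<le> C"
    and f: "\<And>i. i \<in> V \<Longrightarrow> convex_on UNIV (f i)"
      "\<And>i y h. i \<in> V \<Longrightarrow> y \<in> X \<Longrightarrow> h \<in> subdifferential (f i) y \<Longrightarrow> norm h \<le> B"
    and Z: "Z \<noteq> {}"
    and \<alpha>: "\<And>k. 0 < \<alpha> k" "filterlim (\<lambda>K. \<Sum>k<K. \<alpha> k) at_top sequentially" "summable (\<lambda>k. (\<alpha> k)\<^sup>2)"
    and dist: "summable (\<lambda>k. \<Sum>i\<in>V. (infdist (v i k) X)\<^sup>2)"
  shows "\<exists>z\<in>Z. \<forall>i\<in>V. x i \<longlonglongrightarrow> z"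
proof -
  have Xne: "X \<noteq> {}" using Z by (auto simp: Z_def)
  define m where "m k = average V (\<lambda>j. x j k)" for k
  define s where "s k = closest_point X (m k)" for k
  define A where "A k = (\<Sum>i\<in>V. (norm (x i k - m k))\<^sup>2)" for k
  define D where "D k = (\<Sum>i\<in>V. (infdist (v i k) X)\<^sup>2)" for k
  define a where "a z k = (\<Sum>i\<in>V. (norm (x i k - z))\<^sup>2)" for z k
  have sX: "s k \<in> X" for k using X Xne closest_point_in_set by (auto simp: s_def)
  have D: "summable D" using dist by (simp add: D_def[abs_def])

  \<comment> \<open>Summability of the disagreement\<close>
  have A: "summable A"
    unfolding A_def[abs_def] m_def
  proof (rule consensus[OF v])
    have "summable (\<lambda>k. 8 * D k + real (card V) * (2 * C\<^sup>2) * (\<alpha> k)\<^sup>2)"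
      by (intro summable_add summable_mult D \<alpha>)
    moreover have "(\<Sum>i\<in>V. (norm (x i (Suc k) - v i k))\<^sup>2) \<le> 8 * D k + real (card V) * (2 * C\<^sup>2) * (\<alpha> k)\<^sup>2" for k
    proof -
      have "(\<Sum>i\<in>V. (norm (x i (Suc k) - v i k))\<^sup>2) \<le> (\<Sum>i\<in>V. 8 * (infdist (v i k) X)\<^sup>2 + 2 * C\<^sup>2 * (\<alpha> k)\<^sup>2)"
      proof (rule sum_mono)
        fix i assume i: "i \<in> V"
        show "(norm (x i (Suc k) - v i k))\<^sup>2 \<le> 8 * (infdist (v i k) X)\<^sup>2 + 2 * C\<^sup>2 * (\<alpha> k)\<^sup>2"
          unfolding step[OF i]
          by (rule projected_step_displacement[OF X(1) Xne S[OF i] g(2)[OF i] less_imp_le[OF \<alpha>(1)]])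
      qed
      then show ?thesis by (simp add: sum.distrib sum_distrib_left D_def)
    qed
    ultimately show "summable (\<lambda>k. \<Sum>i\<in>V. (norm (x i (Suc k) - v i k))\<^sup>2)"
      by - (rule summable_comparison_test'[where N = 0], assumption, simp add: sum_nonneg)
  qed
  have vm: "(\<Sum>i\<in>V. (norm (v i k - z))\<^sup>2) \<le> (\<Sum>j\<in>V. (norm (x j k - z))\<^sup>2)" for k z
    using mixing_nonexpansive[OF rows[of _ k] cols[of _ k] nonneg[of _ _ k], where z = z and u = "\<lambda>j. x j k"]
    by (simp add: v)
  obtain i0 where i0: "i0 \<in> V" using V by auto
  have B: "B \<ge> 0"
  proof -
    obtain h where "h \<in> subdifferential (f i0) (s 0)"
      using subdifferential_nonempty[OF f(1)[OF i0]] by blast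
    then show ?thesis using f(2)[OF i0 sX] norm_ge_zero[of h] by (meson order_trans)
  qed
  have ms: "norm (m k - s k) = infdist (m k) X" for k
    using X Xne by (simp add: s_def infdist_closest_point)
  \<comment> \<open>The detour passes through \<open>m k\<close>, because \<open>s k\<close> is the
    projection of the mean and not of \<open>v i k\<close>.\<close>
  have vs: "norm (v i k - s k) \<le> 2 * norm (v i k - m k) + infdist (v i k) X" if "i \<in> V" for i k
  proof -
    have "infdist (m k) X \<le> infdist (v i k) X + norm (m k - v i k)"
      using infdist_triangle[of "m k" X "v i k"] by (simp only: dist_norm)
    moreover have "norm (v i k - s k) \<le> norm (v i k - m k) + norm (m k - s k)"
      using norm_triangle_ineq[of "v i k - m k" "m k - s k"] by simp
    moreover have "norm (m k - v i k) = norm (v i k - m k)" by (rule norm_minus_commute)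
    ultimately show ?thesis using ms[of k] by linarith
  qed

  \<comment> \<open>Descent inequality\<close>
  define b where "b k = real (card V) * (C\<^sup>2 + 3 * B) * (\<alpha> k)\<^sup>2 + 2 * B * A k + B * D k" for k
  have b: "summable b" unfolding b_def by (intro summable_add summable_mult A D \<alpha>)
  have descent: "a z (Suc k) + 2 * (\<alpha> k * (F (s k) - F z)) \<le> a z k + b k" if z: "z \<in> X" for z k
  proof -
    have "(norm (x i (Suc k) - z))\<^sup>2 + 2 * (\<alpha> k * (f i (s k) - f i z)) \<le> (norm (v i k - z))\<^sup>2
        + (C\<^sup>2 + 3 * B) * (\<alpha> k)\<^sup>2 + 2 * B * (norm (v i k - m k))\<^sup>2 + B * (infdist (v i k) X)\<^sup>2"
      if i: "i \<in> V" for i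
    proof -
      have "(norm (x i (Suc k) - z))\<^sup>2 + (infdist (v i k - \<alpha> k *\<^sub>R g i k) (S i k))\<^sup>2
          \<le> (norm (v i k - z))\<^sup>2 - 2 * \<alpha> k * (g i k \<bullet> (v i k - z)) + (\<alpha> k)\<^sup>2 * C\<^sup>2"
        unfolding step[OF i] using S[OF i] g(2)[OF i] z by (intro projected_step) auto
      then have 1: "(norm (x i (Suc k) - z))\<^sup>2
          \<le> (norm (v i k - z))\<^sup>2 - 2 * \<alpha> k * (g i k \<bullet> (v i k - z)) + (\<alpha> k)\<^sup>2 * C\<^sup>2"
        by (smt (verit) zero_le_power2)
      have 2: "f i (v i k) - f i z \<le> g i k \<bullet> (v i k - z)"
      proof -
        have "f i z \<ge> f i (v i k) + g i k \<bullet> (z - v i k)"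
          using g(1)[OF i] by (auto simp: subdifferential_def)
        then show ?thesis by (simp add: inner_diff_right)
      qed
      obtain h where h: "h \<in> subdifferential (f i) (s k)"
        using subdifferential_nonempty[OF f(1)[OF i]] by blast
      \<comment> \<open>The bound \<open>B\<close> concerns subgradients at points of
        \<open>X\<close>, so a subgradient at \<open>s k\<close> is used. This is why the objective
        is evaluated at the projected mean.\<close>
      have 3: "f i (s k) - f i (v i k) \<le> B * (2 * norm (v i k - m k) + infdist (v i k) X)"
      proof -
        have "f i (v i k) \<ge> f i (s k) + h \<bullet> (v i k - s k)"
          using h by (auto simp: subdifferential_def)
        moreover have "\<bar>h \<bullet> (v i k - s k)\<bar> \<le> norm h * norm (v i k - s k)"
          by (rule Cauchy_Schwarz_ineq2)
        moreover have "norm h * norm (v i k - s k) \<le> B * (2 * norm (v i k - m k) + infdist (v i k) X)"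
          using f(2)[OF i sX h] vs[OF i] B by (intro mult_mono) auto
        ultimately show ?thesis by linarith
      qed
      have "f i (s k) - f i z \<le> g i k \<bullet> (v i k - z) + B * (2 * norm (v i k - m k) + infdist (v i k) X)"
        using 2 3 by linarith
      then have "2 * \<alpha> k * (f i (s k) - f i z)
          \<le> 2 * \<alpha> k * (g i k \<bullet> (v i k - z) + B * (2 * norm (v i k - m k) + infdist (v i k) X))"
        using \<alpha>(1)[of k] by (intro mult_left_mono) auto
      also have "\<dots> = 2 * \<alpha> k * (g i k \<bullet> (v i k - z))
          + B * (2 * (2 * (\<alpha> k * norm (v i k - m k))) + 2 * (\<alpha> k * infdist (v i k) X))"
        by (simp add: distrib_left mult.assoc mult.left_commute)
      \<comment> \<open>Young's inequality replaces products of the step size with a distance by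
        squares, all of them summable after summing over the users. The coefficients 2 and 1 of
        \<open>(\<alpha> k)\<^sup>2\<close> make up the \<open>3 * B\<close> in
        \<open>b\<close>.\<close>
      also have "\<dots> \<le> 2 * \<alpha> k * (g i k \<bullet> (v i k - z))
          + B * (2 * ((\<alpha> k)\<^sup>2 + (norm (v i k - m k))\<^sup>2) + ((\<alpha> k)\<^sup>2 + (infdist (v i k) X)\<^sup>2))"
        using B two_mult_le_squares[of 1 "\<alpha> k" "norm (v i k - m k)"]
          two_mult_le_squares[of 1 "\<alpha> k" "infdist (v i k) X"]
        by (intro add_left_mono mult_left_mono) auto
      also have "\<dots> = 2 * \<alpha> k * (g i k \<bullet> (v i k - z))
          + (3 * B * (\<alpha> k)\<^sup>2 + 2 * B * (norm (v i k - m k))\<^sup>2 + B * (infdist (v i k) X)\<^sup>2)"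
        by (simp add: distrib_left)
      finally have "2 * \<alpha> k * (f i (s k) - f i z) \<le> \<dots>" .
      moreover have "(C\<^sup>2 + 3 * B) * (\<alpha> k)\<^sup>2 = (\<alpha> k)\<^sup>2 * C\<^sup>2 + 3 * B * (\<alpha> k)\<^sup>2"
        by (simp add: distrib_right)
      ultimately show ?thesis using 1 by argo
    qed
    then have "(\<Sum>i\<in>V. (norm (x i (Suc k) - z))\<^sup>2 + 2 * (\<alpha> k * (f i (s k) - f i z)))
        \<le> (\<Sum>i\<in>V. (norm (v i k - z))\<^sup>2
        + (C\<^sup>2 + 3 * B) * (\<alpha> k)\<^sup>2 + 2 * B * (norm (v i k - m k))\<^sup>2 + B * (infdist (v i k) X)\<^sup>2)"
      by (rule sum_mono)
    also have "\<dots> = (\<Sum>i\<in>V. (norm (v i k - z))\<^sup>2) + real (card V) * (C\<^sup>2 + 3 * B) * (\<alpha> k)\<^sup>2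
        + 2 * B * (\<Sum>i\<in>V. (norm (v i k - m k))\<^sup>2) + B * D k"
      by (simp add: sum.distrib sum_distrib_left D_def)
    \<comment> \<open>Mixing is nonexpansive around both \<open>z\<close> and \<open>m k\<close>, so
      \<open>v\<close> may be replaced by \<open>x\<close>.\<close>
    also have "\<dots> \<le> a z k + real (card V) * (C\<^sup>2 + 3 * B) * (\<alpha> k)\<^sup>2 + 2 * B * A k + B * D k"
      using vm[of k z] vm[of k "m k"] B by (intro add_mono mult_left_mono) (auto simp: a_def A_def)
    finally show ?thesis
      by (simp add: b_def a_def F_def sum.distrib sum_distrib_left sum_subtractf right_diff_distrib)
  qed

  \<comment> \<open>Accumulation points and convergence to a minimizer\<close>
  have a0: "0 \<le> a z k" for z k by (simp add: a_def sum_nonneg)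
  obtain z0 where z0: "z0 \<in> Z" using Z by blast
  have gap: "0 \<le> F (s k) - F z" if "z \<in> Z" for z k using that sX by (auto simp: Z_def)
  have conv: "convergent (a z)" if z: "z \<in> Z" for z
  proof (rule almost_decreasing_convergent[OF a0 _ b])
    fix k
    have "0 \<le> \<alpha> k * (F (s k) - F z)" using gap[OF z] \<alpha>(1)[of k] by simp
    then show "a z (Suc k) \<le> a z k + b k"
      using descent[of z k] z by (simp add: Z_def)
  qed
  have sumgap: "summable (\<lambda>k. \<alpha> k * (F (s k) - F z0))"
  proof -
    have 1: "0 \<le> 2 * (\<alpha> k * (F (s k) - F z0))" for k
      using gap[OF z0] \<alpha>(1)[of k] by simp
    have 2: "z0 \<in> X" using z0 by (simp add: Z_def)
    have "summable (\<lambda>k. 2 * (\<alpha> k * (F (s k) - F z0)))"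
      by (rule almost_decreasing_summable[OF a0[of z0] 1 descent[OF 2] b])
    then show ?thesis by (simp only: summable_cmult_iff) simp
  qed
  have norm_le_root: "norm (u i) \<le> sqrt (\<Sum>i\<in>V. (norm (u i))\<^sup>2)" if "i \<in> V" for i and u :: "'i \<Rightarrow> 'a"
    using that V by (intro real_le_rsqrt member_le_sum) auto
  have xs: "(\<lambda>k. x i k - s k) \<longlonglongrightarrow> 0" if i: "i \<in> V" for i
  proof (rule Lim_null_comparison)
    show "\<forall>\<^sub>F k in sequentially. norm (x i k - s k) \<le> sqrt (A k) + (sqrt (D k) + sqrt (A k))"
    proof (intro always_eventually allI)
      fix k
      have "infdist (m k) X \<le> infdist (v i k) X + norm (m k - v i k)"
        using infdist_triangle[of "m k" X "v i k"] by (simp add: dist_norm)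
      moreover have "infdist (v i k) X \<le> sqrt (D k)"
        unfolding D_def using i V by (intro real_le_rsqrt member_le_sum) auto
      moreover have "norm (x i k - m k) \<le> sqrt (A k)"
        unfolding A_def by (rule norm_le_root[OF i, of "\<lambda>i. x i k - m k"])
      moreover have "norm (v i k - m k) \<le> sqrt (A k)"
        using norm_le_root[OF i, of "\<lambda>i. v i k - m k"] vm[of k "m k"]
        by (auto simp: A_def intro: order.trans)
      ultimately show "norm (x i k - s k) \<le> sqrt (A k) + (sqrt (D k) + sqrt (A k))"
        using norm_triangle_ineq[of "x i k - m k" "m k - s k"] ms[of k] norm_minus_commute[of "m k" "v i k"]
        by simp
    qed
    have "(\<lambda>k. sqrt (A k) + (sqrt (D k) + sqrt (A k))) \<longlonglongrightarrow> sqrt 0 + (sqrt 0 + sqrt 0)"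
      by (intro tendsto_intros summable_LIMSEQ_zero A D)
    then show "(\<lambda>k. sqrt (A k) + (sqrt (D k) + sqrt (A k))) \<longlonglongrightarrow> 0" by simp
  qed
  have bounded_s: "bounded (range s)"
  proof -
    obtain K where K: "\<And>k. norm (a z0 k) \<le> K"
      using convergent_imp_Bseq[OF conv[OF z0]] by (auto simp: Bseq_def)
    obtain L where L: "\<And>k. norm (x i0 k - s k) \<le> L"
      using convergent_imp_Bseq[OF convergentI[OF xs[OF i0]]] by (auto simp: Bseq_def)
    have "norm (s k - z0) \<le> L + sqrt K" for k
    proof -
      have "norm (x i0 k - z0) \<le> sqrt (a z0 k)"
        unfolding a_def by (rule norm_le_root[OF i0, of "\<lambda>i. x i k - z0"])
      also have "\<dots> \<le> sqrt K" using K[of k] by simp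
      finally show ?thesis
        using L[of k] norm_triangle_ineq4[of "x i0 k - z0" "x i0 k - s k"] by simp
    qed
    then have "range s \<subseteq> cball z0 (L + sqrt K)" by (auto simp: dist_norm norm_minus_commute)
    then show ?thesis using bounded_cball bounded_subset by blast
  qed
  have "\<exists>k\<ge>n. F (s k) - F z0 < inverse (real (Suc n))" for n
    using frequently_small_of_weighted_summable[OF \<alpha>(1,2) sumgap] by simp
  \<comment> \<open>\<open>\<kappa>\<close> need not be monotone: \<open>n \<le> \<kappa> n\<close>
    alone makes it tend to infinity, and the convergent subsequence is then extracted along
    it.\<close>
  then obtain \<kappa> where \<kappa>: "\<And>n. n \<le> \<kappa> n" "\<And>n. F (s (\<kappa> n)) - F z0 < inverse (real (Suc n))"
    by metis
  have "bounded (range (s \<circ> \<kappa>))" using bounded_s by (rule bounded_subset) auto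
  then obtain l r where r: "strict_mono r" and l: "((s \<circ> \<kappa>) \<circ> r) \<longlonglongrightarrow> l"
    using bounded_imp_convergent_subsequence by blast
  have sub: "filterlim (\<kappa> \<circ> r) at_top sequentially"
  proof -
    have "filterlim \<kappa> at_top sequentially"
      by (rule filterlim_at_top_mono[OF filterlim_ident]) (simp add: \<kappa>)
    then show ?thesis
      using filterlim_compose[OF _ filterlim_subseq[OF r]] by (simp add: comp_def)
  qed
  have l': "(\<lambda>n. s (\<kappa> (r n))) \<longlonglongrightarrow> l" using l by (simp add: comp_def)
  have "l \<in> X" using X(1) sX l' by (rule closed_sequentially)
  \<comment> \<open>Finite convex functions on the whole space are continuous, so the estimate of
    the gap along the subsequence passes to the limit \<open>l\<close>.\<close>
  have "F l \<le> F z0"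
  proof -
    have "isCont F l"
      unfolding F_def
      using convex_on_continuous[OF open_UNIV f(1)] by (intro continuous_sum) (auto simp: continuous_on_eq_continuous_at)
    then have 1: "(\<lambda>n. F (s (\<kappa> (r n)))) \<longlonglongrightarrow> F l"
      using l' by (rule isCont_tendsto_compose)
    have "(\<lambda>n. F z0 + inverse (real (Suc (r n)))) \<longlonglongrightarrow> F z0 + 0"
      using LIMSEQ_subseq_LIMSEQ[OF LIMSEQ_inverse_real_of_nat r]
      by (intro tendsto_intros) (simp add: comp_def)
    then have 2: "(\<lambda>n. F z0 + inverse (real (Suc (r n)))) \<longlonglongrightarrow> F z0" by simp
    have "F (s (\<kappa> n)) \<le> F z0 + inverse (real (Suc n))" for n using \<kappa>(2)[of n] by linarith
    then show ?thesis by (intro LIMSEQ_le[OF 1 2]) blast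
  qed
  then have lZ: "l \<in> Z" using z0 \<open>l \<in> X\<close> by (force simp: Z_def)
  \<comment> \<open>Since \<open>l\<close> is in \<open>Z\<close>, the whole sequence
    \<open>a l\<close> converges. Its limit can be computed along the subsequence, where every user
    tends to \<open>l\<close>.\<close>
  obtain L where L: "a l \<longlonglongrightarrow> L" using conv[OF lZ] by (auto simp: convergent_def)
  then have "(\<lambda>n. a l (\<kappa> (r n))) \<longlonglongrightarrow> L"
    using filterlim_compose[OF L sub] by (simp add: comp_def)
  moreover have "(\<lambda>n. a l (\<kappa> (r n))) \<longlonglongrightarrow> (\<Sum>i\<in>V. (norm (0 + l - l))\<^sup>2)"
  proof -
    have "(\<lambda>n. (x i (\<kappa> (r n)) - s (\<kappa> (r n))) + s (\<kappa> (r n))) \<longlonglongrightarrow> 0 + l" if "i \<in> V" for i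
      using filterlim_compose[OF xs[OF that] sub] l' by (intro tendsto_add) (auto simp: comp_def)
    then show ?thesis unfolding a_def by (intro tendsto_intros) simp
  qed
  ultimately have "L = 0" using LIMSEQ_unique by fastforce
  with L have aL: "a l \<longlonglongrightarrow> 0" by simp
  have "x i \<longlonglongrightarrow> l" if i: "i \<in> V" for i
  proof -
    have "(\<lambda>k. sqrt (a l k)) \<longlonglongrightarrow> sqrt 0" using aL by (rule tendsto_real_sqrt)
    moreover have "norm (x i k - l) \<le> sqrt (a l k)" for k
      unfolding a_def by (rule norm_le_root[OF i, of "\<lambda>i. x i k - l"])
    ultimately have "(\<lambda>k. x i k - l) \<longlonglongrightarrow> 0"
      by - (rule Lim_null_comparison[where g = "\<lambda>k. sqrt (a l k)"]; simp)
    then show ?thesis by (simp add: LIM_zero_iff)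
  qed
  then show ?thesis using lZ by blast
qed

end

section \<open>Independence of the draws from the history\<close>

text \<open>Induction over nonnegative measurable functions: the hypothesis is the case of
  indicators, and both sides respect scaling, sums and monotone limits. For an event
  \<open>T\<close> independent of \<open>N\<close>, the constant \<open>c\<close> is its
  probability.\<close>

lemma nn_integral_mult_indicator_indep:
  fixes c :: ennreal
  assumes N: "subalgebra M N" and T: "T \<in> sets M"
    and indep: "\<And>A. A \<in> sets N \<Longrightarrow> emeasure M (A \<inter> T) = c * emeasure M A"
    and h: "h \<in> borel_measurable N"
  shows "(\<integral>\<^sup>+\<omega>. h \<omega> * indicator T \<omega> \<partial>M) = c * (\<integral>\<^sup>+\<omega>. h \<omega> \<partial>M)"
  using h
proof (induction h rule: borel_measurable_induct)
  case (cong f g)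
  have "space M = space N" using N by (simp add: subalgebra_def)
  then have "(\<integral>\<^sup>+\<omega>. f \<omega> * indicator T \<omega> \<partial>M) = (\<integral>\<^sup>+\<omega>. g \<omega> * indicator T \<omega> \<partial>M)"
    "(\<integral>\<^sup>+\<omega>. f \<omega> \<partial>M) = (\<integral>\<^sup>+\<omega>. g \<omega> \<partial>M)"
    using cong(3) by (auto intro!: nn_integral_cong)
  with cong(4) show ?case by (simp only:)
next
  case (set A)
  then have "A \<in> sets M" using N by (auto simp: subalgebra_def)
  then show ?case using T indep[OF set] by (simp add: indicator_inter_arith[symmetric])
next
  case (mult u a)
  have u: "u \<in> borel_measurable M" using measurable_from_subalg[OF N] mult by blast
  then have "(\<integral>\<^sup>+\<omega>. a * (u \<omega> * indicator T \<omega>) \<partial>M) = a * (\<integral>\<^sup>+\<omega>. u \<omega> * indicator T \<omega> \<partial>M)"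
    using T by (intro nn_integral_cmult borel_measurable_times_ennreal borel_measurable_indicator)
  then show ?case using u mult.IH by (simp add: nn_integral_cmult mult_ac)
next
  case (add u v)
  have [measurable]: "u \<in> borel_measurable M" "v \<in> borel_measurable M" "T \<in> sets M"
    using measurable_from_subalg[OF N] add T by blast+
  have "(\<integral>\<^sup>+\<omega>. v \<omega> * indicator T \<omega> + u \<omega> * indicator T \<omega> \<partial>M) =
      (\<integral>\<^sup>+\<omega>. v \<omega> * indicator T \<omega> \<partial>M) + (\<integral>\<^sup>+\<omega>. u \<omega> * indicator T \<omega> \<partial>M)"
    by (intro nn_integral_add) measurable
  then show ?case using add.IH by (simp add: nn_integral_add distrib_left distrib_right)
next
  case (seq U)
  have [measurable]: "U i \<in> borel_measurable M" "T \<in> sets M" for i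
    using measurable_from_subalg[OF N] seq T by blast+
  have "(\<integral>\<^sup>+\<omega>. (SUP i. U i) \<omega> * indicator T \<omega> \<partial>M) = (\<integral>\<^sup>+\<omega>. (SUP i. U i \<omega> * indicator T \<omega>) \<partial>M)"
    by (simp add: SUP_apply image_comp SUP_mult_right_ennreal)
  also have "\<dots> = (SUP i. \<integral>\<^sup>+\<omega>. U i \<omega> * indicator T \<omega> \<partial>M)"
    using \<open>incseq U\<close> by (intro nn_integral_monotone_convergence_SUP)
      (auto simp: incseq_def le_fun_def intro!: mult_right_mono)
  also have "\<dots> = (SUP i. c * \<integral>\<^sup>+\<omega>. U i \<omega> \<partial>M)" using seq.IH by simp
  also have "\<dots> = c * (SUP i. \<integral>\<^sup>+\<omega>. U i \<omega> \<partial>M)" by (simp add: SUP_mult_left_ennreal)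
  also have "(SUP i. \<integral>\<^sup>+\<omega>. U i \<omega> \<partial>M) = (\<integral>\<^sup>+\<omega>. (SUP i. U i \<omega>) \<partial>M)"
    using \<open>incseq U\<close> by (intro nn_integral_monotone_convergence_SUP[symmetric]) auto
  finally show ?case by (simp add: SUP_apply image_comp)
qed

text \<open>Splitting by the value of the choice leaves on each piece a function measurable for
  \<open>N\<close>, and independence replaces the indicator of the piece by its probability. This
  does the work of a conditional expectation given \<open>N\<close>.\<close>

lemma (in prob_space) nn_integral_independent_choice:
  fixes \<phi> :: "'j \<Rightarrow> 'a \<Rightarrow> ennreal"
  assumes K: "finite K" and T: "T \<in> measurable M (count_space K)" and N: "subalgebra M N"
    and indep: "\<And>A j. A \<in> sets N \<Longrightarrow> j \<in> K \<Longrightarrow>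
      prob (A \<inter> {\<omega> \<in> space M. T \<omega> = j}) = prob A * prob {\<omega> \<in> space M. T \<omega> = j}"
    and \<phi>: "\<And>j. j \<in> K \<Longrightarrow> \<phi> j \<in> borel_measurable N"
  shows "(\<integral>\<^sup>+\<omega>. \<phi> (T \<omega>) \<omega> \<partial>M) = (\<integral>\<^sup>+\<omega>. (\<Sum>j\<in>K. ennreal (prob {\<omega> \<in> space M. T \<omega> = j}) * \<phi> j \<omega>) \<partial>M)"
proof -
  let ?T = "\<lambda>j. {\<omega> \<in> space M. T \<omega> = j}"
  have T': "T \<omega> \<in> K" if "\<omega> \<in> space M" for \<omega> using measurable_space[OF T that] by simp
  have Tj: "?T j \<in> events" if "j \<in> K" for j
  proof -
    have "T -` {j} \<inter> space M \<in> events" using T that by (intro measurable_sets[OF T]) auto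
    also have "T -` {j} \<inter> space M = ?T j" by auto
    finally show ?thesis .
  qed
  have \<phi>M: "\<phi> j \<in> borel_measurable M" if "j \<in> K" for j
    using measurable_from_subalg[OF N \<phi>[OF that]] .
  have "(\<integral>\<^sup>+\<omega>. \<phi> (T \<omega>) \<omega> \<partial>M) = (\<integral>\<^sup>+\<omega>. (\<Sum>j\<in>K. \<phi> j \<omega> * indicator (?T j) \<omega>) \<partial>M)"
  proof (rule nn_integral_cong)
    fix \<omega> assume \<omega>: "\<omega> \<in> space M"
    have "(\<Sum>j\<in>K. \<phi> j \<omega> * indicator (?T j) \<omega>) = (\<Sum>j\<in>K. if j = T \<omega> then \<phi> j \<omega> else 0)"
      using \<omega> by (intro sum.cong) (auto simp: indicator_def)
    then show "\<phi> (T \<omega>) \<omega> = (\<Sum>j\<in>K. \<phi> j \<omega> * indicator (?T j) \<omega>)"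
      using K T'[OF \<omega>] by (simp add: sum.delta)
  qed
  also have "\<dots> = (\<Sum>j\<in>K. \<integral>\<^sup>+\<omega>. \<phi> j \<omega> * indicator (?T j) \<omega> \<partial>M)"
    using Tj \<phi>M by (intro nn_integral_sum) (auto intro!: borel_measurable_times_ennreal)
  also have "\<dots> = (\<Sum>j\<in>K. ennreal (prob (?T j)) * (\<integral>\<^sup>+\<omega>. \<phi> j \<omega> \<partial>M))"
  proof (rule sum.cong[OF refl])
    fix j assume j: "j \<in> K"
    show "(\<integral>\<^sup>+\<omega>. \<phi> j \<omega> * indicator (?T j) \<omega> \<partial>M) = ennreal (prob (?T j)) * (\<integral>\<^sup>+\<omega>. \<phi> j \<omega> \<partial>M)"
      using indep[OF _ j]
      by (intro nn_integral_mult_indicator_indep[OF N Tj[OF j] _ \<phi>[OF j]])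
        (simp add: emeasure_eq_measure ennreal_mult[symmetric] mult.commute)
  qed
  also have "\<dots> = (\<integral>\<^sup>+\<omega>. (\<Sum>j\<in>K. ennreal (prob (?T j)) * \<phi> j \<omega>) \<partial>M)"
    using \<phi>M by (subst nn_integral_sum) (auto simp: nn_integral_cmult intro!: sum.cong)
  finally show ?thesis .
qed

text \<open>
  The term \<open>2 \<delta>\<close> stays on the left because extended nonnegative integrals cannot be subtracted
  before they are known to be finite.
\<close>

lemma AE_summable_of_almost_decreasing:
  fixes h :: "nat \<Rightarrow> 'a \<Rightarrow> real"
  assumes [measurable]: "\<And>k. h k \<in> borel_measurable M" and h0: "\<And>k \<omega>. 0 \<le> h k \<omega>"
    and fin: "(\<integral>\<^sup>+\<omega>. h 0 \<omega> \<partial>M) < \<infinity>"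
    and \<delta>: "\<delta> > 0" and b: "summable b" "\<And>k. 0 \<le> b k"
    and step: "\<And>k. (\<integral>\<^sup>+\<omega>. h (Suc k) \<omega> \<partial>M) + ennreal (2 * \<delta>) * (\<integral>\<^sup>+\<omega>. h k \<omega> \<partial>M)
      \<le> ennreal (1 + \<delta>) * (\<integral>\<^sup>+\<omega>. h k \<omega> \<partial>M) + ennreal (b k)"
  shows "AE \<omega> in M. summable (\<lambda>k. h k \<omega>)"
proof -
  define a where "a k = enn2real (\<integral>\<^sup>+\<omega>. h k \<omega> \<partial>M)" for k
  \<comment> \<open>Dropping the term with \<open>2 * \<delta>\<close> gives finiteness inductively;
    afterwards the inequality can be read over the reals and the terms subtracted.\<close>
  have finite: "(\<integral>\<^sup>+\<omega>. h k \<omega> \<partial>M) < \<infinity>" for k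
  proof (induction k)
    case (Suc k)
    have "(\<integral>\<^sup>+\<omega>. h (Suc k) \<omega> \<partial>M) \<le> ennreal (1 + \<delta>) * (\<integral>\<^sup>+\<omega>. h k \<omega> \<partial>M) + ennreal (b k)"
      by (rule order_trans[OF _ step[of k]]) (rule add_increasing2, simp_all)
    also have "\<dots> < \<infinity>" using Suc by (simp add: ennreal_mult_less_top)
    finally show ?case .
  qed (rule fin)
  then have a: "(\<integral>\<^sup>+\<omega>. h k \<omega> \<partial>M) = ennreal (a k)" for k
    by (simp add: a_def)
  have a0: "0 \<le> a k" for k by (simp add: a_def)
  have "a (Suc k) + \<delta> * a k \<le> a k + b k" for k
  proof -
    have "ennreal (a (Suc k) + 2 * \<delta> * a k) \<le> ennreal ((1 + \<delta>) * a k + b k)"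
      using step[of k] \<delta> a0 b(2)[of k] by (simp add: a flip: ennreal_mult ennreal_plus)
    then have "a (Suc k) + 2 * \<delta> * a k \<le> (1 + \<delta>) * a k + b k"
      using \<delta> a0[of k] b(2)[of k] by (subst (asm) ennreal_le_iff) auto
    then show ?thesis by (simp add: algebra_simps)
  qed
  from almost_decreasing_summable[OF a0 _ this b(1)] a0 \<delta>
  have "summable (\<lambda>k. \<delta> * a k)" by simp
  then have sa: "summable a" using \<delta> by (simp add: summable_cmult_iff)
  \<comment> \<open>The expectations are summable, so the random series has finite expectation and
    is finite almost everywhere.\<close>
  have "(\<integral>\<^sup>+\<omega>. (\<Sum>k. ennreal (h k \<omega>)) \<partial>M) = (\<Sum>k. \<integral>\<^sup>+\<omega>. h k \<omega> \<partial>M)"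
    by (rule nn_integral_suminf) measurable
  also have "\<dots> = ennreal (\<Sum>k. a k)" using sa a0 by (simp add: a suminf_ennreal2)
  finally have "(\<integral>\<^sup>+\<omega>. (\<Sum>k. ennreal (h k \<omega>)) \<partial>M) \<noteq> \<infinity>" by simp
  then have "AE \<omega> in M. (\<Sum>k. ennreal (h k \<omega>)) \<noteq> \<infinity>"
    by (rule nn_integral_PInf_AE[rotated]) measurable
  then show ?thesis
    by eventually_elim (rule summable_suminf_not_top, auto simp: h0)
qed

lemma space_history [simp]: "space (history M V J x0 \<Omega> k) = space M"
  by (auto simp: history_def space_measure_of_conv)

lemma sets_history: "sets (history M V J x0 \<Omega> k) = sigma_sets (space M)
     ({x0 i -` B \<inter> space M | i B. i \<in> V \<and> B \<in> sets borel} \<union>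
      {\<Omega> i l -` A \<inter> space M | i l A. i \<in> V \<and> l < k \<and> A \<subseteq> J i})"
  unfolding history_def by (rule sets_measure_of) auto

lemma history_mono: "k \<le> l \<Longrightarrow> subalgebra (history M V J x0 \<Omega> l) (history M V J x0 \<Omega> k)"
  unfolding subalgebra_def sets_history space_history
proof (intro conjI refl sigma_sets_mono' Un_mono order.refl subsetI)
  fix A assume "k \<le> l" "A \<in> {\<Omega> i l -` A \<inter> space M | i l A. i \<in> V \<and> l < k \<and> A \<subseteq> J i}"
  then show "A \<in> {\<Omega> i l' -` A \<inter> space M | i l' A. i \<in> V \<and> l' < l \<and> A \<subseteq> J i}"
    by clarsimp (metis order.strict_trans2)
qed

lemma history_measurable_initial: "i \<in> V \<Longrightarrow> x0 i \<in> borel_measurable (history M V J x0 \<Omega> k)"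
  by (intro measurableI) (auto simp: sets_history intro!: sigma_sets.Basic)

lemma history_measurable_draw:
  assumes "i \<in> V" "l < k" "\<And>\<omega>. \<omega> \<in> space M \<Longrightarrow> \<Omega> i l \<omega> \<in> J i"
  shows "\<Omega> i l \<in> measurable (history M V J x0 \<Omega> k) (count_space (J i))"
  using assms by (intro measurableI) (auto simp: sets_history intro!: sigma_sets.Basic)

lemma history_subalgebra:
  assumes "\<And>i. i \<in> V \<Longrightarrow> x0 i \<in> borel_measurable M"
    and "\<And>i l. i \<in> V \<Longrightarrow> \<Omega> i l \<in> measurable M (count_space (J i))"
  shows "subalgebra M (history M V J x0 \<Omega> k)"
  unfolding subalgebra_def sets_history space_history
proof (intro conjI refl sets.sigma_sets_subset Un_least subsetI)
  fix A assume "A \<in> {x0 i -` B \<inter> space M | i B. i \<in> V \<and> B \<in> sets borel}"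
  then show "A \<in> sets M" using assms(1) by (auto intro: measurable_sets)
next
  fix A assume "A \<in> {\<Omega> i l -` A \<inter> space M | i l A. i \<in> V \<and> l < k \<and> A \<subseteq> J i}"
  then show "A \<in> sets M" using assms(2) by (auto intro!: measurable_sets)
qed

text \<open>The history is contained in the \<sigma>-algebra generated by the intersection-stable
  family \<open>G\<close> of joint events of the initial points and the earlier draws, so
  independence need only be checked there. First the initial points are split off from all draws,
  then the earlier draws from the next one, and the first two factors are recombined.\<close>

lemma (in prob_space) history_indep_next_draw:
  fixes x0 :: "'i \<Rightarrow> 'a \<Rightarrow> 'b::topological_space" and \<Omega> :: "'i \<Rightarrow> nat \<Rightarrow> 'a \<Rightarrow> 'j"
  assumes x0: "\<And>i. i \<in> V \<Longrightarrow> x0 i \<in> borel_measurable M"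
    and indep: "indep_vars (\<lambda>(i, k). count_space (J i)) (\<lambda>(i, k). \<Omega> i k) (V \<times> UNIV)"
    and indep_initial: "indep_set
          (sets (vimage_algebra (space M) (\<lambda>\<omega>. \<lambda>i\<in>V. x0 i \<omega>) (\<Pi>\<^sub>M i\<in>V. borel)))
          (sets (vimage_algebra (space M) (\<lambda>\<omega>. \<lambda>(i, k)\<in>V \<times> UNIV. \<Omega> i k \<omega>)
            (\<Pi>\<^sub>M (i, k)\<in>V \<times> UNIV. count_space (J i))))"
    and i: "i \<in> V" and A: "A \<in> sets (history M V J x0 \<Omega> k)" and T: "T \<subseteq> J i"
  shows "prob (A \<inter> (\<Omega> i k -` T \<inter> space M)) = prob A * prob (\<Omega> i k -` T \<inter> space M)"
proof -
  define P0 where "P0 = (\<Pi>\<^sub>M i\<in>V. (borel :: 'b measure))"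
  define N where "N = (\<lambda>(i, k::nat). count_space (J i))"
  define X0 where "X0 = (\<lambda>\<omega>. \<lambda>i\<in>V. x0 i \<omega>)"
  define W where "W = (\<lambda>p \<omega>. case p of (i, k) \<Rightarrow> \<Omega> i k \<omega>)"
  define Y where "Y I \<omega> = restrict (\<lambda>p. W p \<omega>) I" for I \<omega>
  define I where "I = V \<times> {..<k}"
  have indep': "indep_vars N W (V \<times> UNIV)"
    using indep by (simp add: N_def W_def case_prod_unfold)
  have init': "indep_set (sets (vimage_algebra (space M) X0 P0))
      (sets (vimage_algebra (space M) (Y (V \<times> UNIV)) (PiM (V \<times> UNIV) N)))"
    using indep_initial
    by (simp add: N_def W_def X0_def P0_def Y_def[abs_def] case_prod_unfold)
  have rv: "random_variable (N p) (W p)" if "p \<in> V \<times> UNIV" for p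
    using indep' that by (auto simp: indep_vars_def)
  have X0: "X0 \<in> measurable M P0" unfolding X0_def P0_def using x0 by (intro measurable_restrict)
  have Y: "Y K \<in> measurable M (PiM K N)" if "K \<subseteq> V \<times> UNIV" for K
    unfolding Y_def using rv that by (intro measurable_restrict) auto
  \<comment> \<open>The \<sigma>-algebra of all draws. Events of the earlier draws and of the next
    one both lie in it, so independence from the initial points applies to their
    intersections.\<close>
  let ?F = "vimage_algebra (space M) (Y (V \<times> UNIV)) (PiM (V \<times> UNIV) N)"
  have YF: "Y K \<in> measurable ?F (PiM K N)" if "K \<subseteq> V \<times> UNIV" for K
  proof -
    have "Y (V \<times> UNIV) \<in> measurable ?F (PiM (V \<times> UNIV) N)"
      using measurable_space[OF Y[OF order.refl]] by (intro measurable_vimage_algebra1) auto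
    then have "(\<lambda>\<omega>. restrict (Y (V \<times> UNIV) \<omega>) K) \<in> measurable ?F (PiM K N)"
      by (rule measurable_compose[OF _ measurable_restrict_subset[OF that]])
    also have "(\<lambda>\<omega>. restrict (Y (V \<times> UNIV) \<omega>) K) = Y K"
      using that by (auto simp: Y_def fun_eq_iff restrict_def)
    finally show ?thesis .
  qed
  define G where "G = {(X0 -` B \<inter> space M) \<inter> (Y I -` B' \<inter> space M) | B B'. B \<in> sets P0 \<and> B' \<in> sets (PiM I N)}"
  define H where "H = {\<Omega> i k -` T \<inter> space M | T. T \<subseteq> J i}"
  have I: "I \<subseteq> V \<times> UNIV" by (auto simp: I_def)
  have "indep_set G H"
    unfolding indep_sets2_eq
  proof (intro conjI ballI)
    show "G \<subseteq> events" using X0 Y[OF I] by (auto simp: G_def)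
    show "H \<subseteq> events"
      using rv[of "(i, k)"] i by (auto simp: H_def W_def N_def intro!: measurable_sets)
    fix a b assume "a \<in> G" "b \<in> H"
    then obtain B B' T where a: "a = (X0 -` B \<inter> space M) \<inter> (Y I -` B' \<inter> space M)"
      and B: "B \<in> sets P0" "B' \<in> sets (PiM I N)" and b: "b = \<Omega> i k -` T \<inter> space M" and T: "T \<subseteq> J i"
      by (auto simp: G_def H_def)
    let ?T = "{y \<in> space (PiM {(i, k)} N). y (i, k) \<in> T}"
    have ik: "{(i, k)} \<subseteq> V \<times> UNIV" using i by auto
    have T': "?T \<in> sets (PiM {(i, k)} N)"
    proof -
      have "T \<in> sets (N (i, k))" using T by (simp add: N_def)
      then show ?thesis by measurable
    qed
    have b': "b = Y {(i, k)} -` ?T \<inter> space M"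
      using measurable_space[OF Y[OF ik]] by (auto simp: b Y_def W_def)
    have YB: "Y I -` B' \<inter> space M \<in> sets ?F" using measurable_sets[OF YF[OF I] B(2)] by simp
    have bF: "b \<in> sets ?F" unfolding b' using measurable_sets[OF YF[OF ik] T'] by simp
    have XB: "X0 -` B \<inter> space M \<in> sets (vimage_algebra (space M) X0 P0)"
      by (rule in_vimage_algebra[OF B(1)])
    have ind: "prob ((Y I -` B' \<inter> space M) \<inter> b) = prob (Y I -` B' \<inter> space M) * prob b"
    proof -
      have "I \<inter> {(i, k)} = {}" by (auto simp: I_def)
      then have "indep_var (PiM I N) (Y I) (PiM {(i, k)} N) (Y {(i, k)})"
        unfolding Y_def[abs_def] using indep_var_restrict[OF indep' _ I ik] by blast
      from indep_varD[OF this B(2) T']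
      show ?thesis unfolding b' by (simp add: vimage_Times Int_ac) (simp add: vimage_def Int_def conj_ac)
    qed
    have "prob (a \<inter> b) = prob ((X0 -` B \<inter> space M) \<inter> ((Y I -` B' \<inter> space M) \<inter> b))"
      by (simp add: a Int_assoc)
    also have "\<dots> = prob (X0 -` B \<inter> space M) * prob ((Y I -` B' \<inter> space M) \<inter> b)"
      using indep_setD[OF init' XB] YB bF by blast
    also have "\<dots> = prob (X0 -` B \<inter> space M) * prob (Y I -` B' \<inter> space M) * prob b"
      by (simp add: ind)
    also have "prob (X0 -` B \<inter> space M) * prob (Y I -` B' \<inter> space M) = prob a"
      unfolding a using indep_setD[OF init' XB YB] by simp
    finally show "prob (a \<inter> b) = prob a * prob b" .
  qed
  moreover have "Int_stable G"
  proof (rule Int_stableI)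
    fix a a' assume "a \<in> G" "a' \<in> G"
    then obtain B B' C C' where *: "B \<in> sets P0" "B' \<in> sets (PiM I N)" "C \<in> sets P0" "C' \<in> sets (PiM I N)"
      and a: "a = (X0 -` B \<inter> space M) \<inter> (Y I -` B' \<inter> space M)" "a' = (X0 -` C \<inter> space M) \<inter> (Y I -` C' \<inter> space M)"
      by (auto simp: G_def)
    have "a \<inter> a' = (X0 -` (B \<inter> C) \<inter> space M) \<inter> (Y I -` (B' \<inter> C') \<inter> space M)"
      by (auto simp: a)
    moreover have "B \<inter> C \<in> sets P0" "B' \<inter> C' \<in> sets (PiM I N)" using * by auto
    ultimately show "a \<inter> a' \<in> G" unfolding G_def by blast
  qed
  moreover have "Int_stable H"
  proof (rule Int_stableI)
    fix b b' assume "b \<in> H" "b' \<in> H"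
    then obtain T T' where "b = \<Omega> i k -` T \<inter> space M" "b' = \<Omega> i k -` T' \<inter> space M" "T \<subseteq> J i" "T' \<subseteq> J i"
      by (auto simp: H_def)
    then have "b \<inter> b' = \<Omega> i k -` (T \<inter> T') \<inter> space M" "T \<inter> T' \<subseteq> J i" by auto
    then show "b \<inter> b' \<in> H" unfolding H_def by blast
  qed
  ultimately have ind: "indep_set (sigma_sets (space M) G) (sigma_sets (space M) H)"
    by (rule indep_set_sigma_sets)
  have "sets (history M V J x0 \<Omega> k) \<subseteq> sigma_sets (space M) G"
    unfolding sets_history
  proof (rule sigma_sets_mono, safe)
    fix i' and B :: "'b set" assume "i' \<in> V" "B \<in> sets borel"
    then have "{y \<in> space P0. y i' \<in> B} \<in> sets P0" unfolding P0_def by measurable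
    \<comment> \<open>A condition on one initial point becomes a member of \<open>G\<close> by
      letting the factor of the draws be the whole space.\<close>
    moreover have "x0 i' -` B \<inter> space M = (X0 -` {y \<in> space P0. y i' \<in> B} \<inter> space M) \<inter> (Y I -` space (PiM I N) \<inter> space M)"
      using measurable_space[OF X0] measurable_space[OF Y[OF I]] \<open>i' \<in> V\<close> by (auto simp: X0_def)
    ultimately show "x0 i' -` B \<inter> space M \<in> sigma_sets (space M) G"
      unfolding G_def by (intro sigma_sets.Basic) blast
  next
    fix i' l T assume *: "i' \<in> V" "l < k" "T \<subseteq> J i'"
    then have "(i', l) \<in> I" "T \<in> sets (N (i', l))" by (auto simp: I_def N_def)
    then have "{y \<in> space (PiM I N). y (i', l) \<in> T} \<in> sets (PiM I N)" by measurable
    moreover have "\<Omega> i' l -` T \<inter> space M = (X0 -` space P0 \<inter> space M) \<inter> (Y I -` {y \<in> space (PiM I N). y (i', l) \<in> T} \<inter> space M)"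
      using measurable_space[OF X0] measurable_space[OF Y[OF I]] \<open>(i', l) \<in> I\<close> by (auto simp: Y_def W_def)
    ultimately show "\<Omega> i' l -` T \<inter> space M \<in> sigma_sets (space M) G"
      unfolding G_def by (intro sigma_sets.Basic) blast
  qed
  moreover have "\<Omega> i k -` T \<inter> space M \<in> sigma_sets (space M) H"
    using T by (intro sigma_sets.Basic) (auto simp: H_def)
  ultimately show ?thesis using indep_setD[OF ind] A by blast
qed

section \<open>Almost sure summability of the distances\<close>

text \<open>Feasibility is studied separately from optimality: the objective is seen only through
  the almost sure bound \<open>C\<close> on the directions \<open>g\<close>, common to all
  users.\<close>

locale random_projection_run = prob_space M + consensus_network V E w w0
  for M :: "'w measure" and V :: "'i set" and E w w0 +
  fixes J :: "'i \<Rightarrow> 'j set" and Xc :: "'i \<Rightarrow> 'j \<Rightarrow> 'a::euclidean_space set" and \<alpha> :: "nat \<Rightarrow> real"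
    and \<Omega> :: "'i \<Rightarrow> nat \<Rightarrow> 'w \<Rightarrow> 'j" and x v g :: "'i \<Rightarrow> nat \<Rightarrow> 'w \<Rightarrow> 'a" and C c :: real
  assumes finite_J: "\<And>i. i \<in> V \<Longrightarrow> finite (J i)"
    and initial: "\<And>i. i \<in> V \<Longrightarrow> x i 0 \<in> borel_measurable M"
    and mixing: "\<And>i k \<omega>. i \<in> V \<Longrightarrow> \<omega> \<in> space M \<Longrightarrow> v i k \<omega> = (\<Sum>j\<in>V. w i j k *\<^sub>R x j k \<omega>)"
    and adapted: "\<And>i k. i \<in> V \<Longrightarrow> g i k \<in> borel_measurable (history M V J (\<lambda>i. x i 0) \<Omega> k)"
    and step: "\<And>i k \<omega>. i \<in> V \<Longrightarrow> \<omega> \<in> space M \<Longrightarrow>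
          x i (Suc k) \<omega> = closest_point (Xc i (\<Omega> i k \<omega>)) (v i k \<omega> - \<alpha> k *\<^sub>R g i k \<omega>)"
    and constraint_sets: "\<And>i j. i \<in> V \<Longrightarrow> j \<in> J i \<Longrightarrow> closed (Xc i j)"
      "\<And>i j. i \<in> V \<Longrightarrow> j \<in> J i \<Longrightarrow> convex (Xc i j)" "feasible_set V J Xc \<noteq> {}"
    and bounded: "\<And>i. i \<in> V \<Longrightarrow> AE \<omega> in M. \<forall>k. norm (g i k \<omega>) \<le> C"
    and indep: "indep_vars (\<lambda>(i, k). count_space (J i)) (\<lambda>(i, k). \<Omega> i k) (V \<times> UNIV)"
    and indep_initial: "indep_set
          (sets (vimage_algebra (space M) (\<lambda>\<omega>. \<lambda>i\<in>V. x i 0 \<omega>) (\<Pi>\<^sub>M i\<in>V. borel)))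
          (sets (vimage_algebra (space M) (\<lambda>\<omega>. \<lambda>(i, k)\<in>V \<times> UNIV. \<Omega> i k \<omega>)
            (\<Pi>\<^sub>M (i, k)\<in>V \<times> UNIV. count_space (J i))))"
    and regularity: "0 < c" "\<And>i y k. i \<in> V \<Longrightarrow>
          (infdist y (feasible_set V J Xc))\<^sup>2 \<le> c * (\<integral>\<omega>. (infdist y (Xc i (\<Omega> i k \<omega>)))\<^sup>2 \<partial>M)"
    and steps: "\<And>k. 0 \<le> \<alpha> k" "summable (\<lambda>k. (\<alpha> k)\<^sup>2)"
begin

abbreviation X :: "'a set" where "X \<equiv> feasible_set V J Xc"

abbreviation F :: "nat \<Rightarrow> 'w measure" where "F \<equiv> history M V J (\<lambda>i. x i 0) \<Omega>"

lemma X_subset: "i \<in> V \<Longrightarrow> j \<in> J i \<Longrightarrow> X \<subseteq> Xc i j"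
  by (auto simp: feasible_set_def user_set_def)

lemma closed_X: "closed X"
  unfolding feasible_set_def user_set_def using constraint_sets by (intro closed_INT ballI) auto

lemma convex_X: "convex X"
  unfolding feasible_set_def user_set_def using constraint_sets by (intro convex_INT) auto

lemma draw_measurable: "i \<in> V \<Longrightarrow> \<Omega> i k \<in> measurable M (count_space (J i))"
  using indep unfolding indep_vars_def by force

lemma draw_in: "i \<in> V \<Longrightarrow> \<omega> \<in> space M \<Longrightarrow> \<Omega> i k \<omega> \<in> J i"
  using measurable_space[OF draw_measurable, of i \<omega> k] by simp

lemma history_subalg: "subalgebra M (F k)"
  using initial draw_measurable by (rule history_subalgebra)

lemma measurable_historyD: "h \<in> measurable (F k) N \<Longrightarrow> h \<in> measurable M N"
  by (rule measurable_from_subalg[OF history_subalg])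

text \<open>The induction alternates between the two families: \<open>v i k\<close> is a combination
  of the \<open>x j k\<close>, while \<open>x i (Suc k)\<close> also involves the draw at time
  \<open>k\<close>, which enters the history at \<open>Suc k\<close>. For each fixed index the
  projection is continuous, and only finitely many indices occur.\<close>

lemma iterate_and_mix_measurable:
  "(\<forall>i\<in>V. x i k \<in> borel_measurable (F k)) \<and> (\<forall>i\<in>V. v i k \<in> borel_measurable (F k))"
proof -
  have mix: "\<forall>i\<in>V. v i k \<in> borel_measurable (F k)" if "\<forall>i\<in>V. x i k \<in> borel_measurable (F k)" for k
  proof
    fix i assume i: "i \<in> V"
    have "(\<lambda>\<omega>. \<Sum>j\<in>V. w i j k *\<^sub>R x j k \<omega>) \<in> borel_measurable (F k)"
      using that by (intro borel_measurable_sum borel_measurable_scaleR borel_measurable_const) auto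
    then show "v i k \<in> borel_measurable (F k)"
      using mixing[OF i] by (subst measurable_cong) auto
  qed
  have "\<forall>i\<in>V. x i k \<in> borel_measurable (F k)"
  proof (induction k)
    case 0
    show ?case by (intro ballI history_measurable_initial)
  next
    case (Suc k)
    show ?case
    proof
      fix i assume i: "i \<in> V"
      let ?y = "\<lambda>\<omega>. v i k \<omega> - \<alpha> k *\<^sub>R g i k \<omega>"
      have "?y \<in> borel_measurable (F k)"
        using mix[OF Suc] adapted i by (intro borel_measurable_diff borel_measurable_scaleR) auto
      then have y: "?y \<in> borel_measurable (F (Suc k))"
        by (rule measurable_from_subalg[OF history_mono[OF le_SucI[OF order.refl]]])
      have "(\<lambda>\<omega>. closest_point (Xc i (\<Omega> i k \<omega>)) (?y \<omega>)) \<in> borel_measurable (F (Suc k))"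
      proof (rule measurable_compose_countable'[where I = "J i"])
        fix j assume j: "j \<in> J i"
        have "closest_point (Xc i j) \<in> borel_measurable borel"
          using constraint_sets i j X_subset[OF i j]
          by (intro borel_measurable_continuous_onI continuous_on_closest_point) auto
        with y show "(\<lambda>\<omega>. closest_point (Xc i j) (?y \<omega>)) \<in> borel_measurable (F (Suc k))"
          by (rule measurable_compose)
      next
        show "\<Omega> i k \<in> measurable (F (Suc k)) (count_space (J i))"
          using i draw_in by (intro history_measurable_draw) auto
        show "countable (J i)" using finite_J[OF i] by (rule countable_finite)
      qed
      then show "x i (Suc k) \<in> borel_measurable (F (Suc k))"
        using step[OF i] by (subst measurable_cong) auto
    qed
  qed
  with mix show ?thesis by blast
qed

lemma iterate_measurable: "i \<in> V \<Longrightarrow> x i k \<in> borel_measurable (F k)"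
  and mix_measurable: "i \<in> V \<Longrightarrow> v i k \<in> borel_measurable (F k)"
  using iterate_and_mix_measurable by auto

lemma infdist_measurable: "h \<in> borel_measurable N \<Longrightarrow> (\<lambda>\<omega>. infdist (h \<omega>) S) \<in> borel_measurable N"
  by (rule measurable_compose[OF _ borel_measurable_continuous_onI[OF continuous_on_infdist]])
    (auto intro: continuous_on_id)

lemma draw_average:
  assumes i: "i \<in> V" and \<phi>: "\<And>j. j \<in> J i \<Longrightarrow> \<phi> j \<in> borel_measurable (F k)"
  shows "(\<integral>\<^sup>+\<omega>. \<phi> (\<Omega> i k \<omega>) \<omega> \<partial>M) =
    (\<integral>\<^sup>+\<omega>. (\<Sum>j\<in>J i. ennreal (prob {\<omega> \<in> space M. \<Omega> i k \<omega> = j}) * \<phi> j \<omega>) \<partial>M)"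
proof (rule nn_integral_independent_choice[OF finite_J[OF i] draw_measurable[OF i] history_subalg _ \<phi>])
  fix A j assume A: "A \<in> sets (F k)" and j: "j \<in> J i"
  have "\<Omega> i k -` {j} \<inter> space M = {\<omega> \<in> space M. \<Omega> i k \<omega> = j}" by auto
  then show "prob (A \<inter> {\<omega> \<in> space M. \<Omega> i k \<omega> = j}) = prob A * prob {\<omega> \<in> space M. \<Omega> i k \<omega> = j}"
    using history_indep_next_draw[OF initial indep indep_initial i A, of "{j}"] j by simp
qed

text \<open>The regularity condition speaks of deterministic points \<open>y\<close>. With the
  expectation written as a finite sum it can be evaluated at the random point
  \<open>v i k \<omega>\<close> and then integrated.\<close>

lemma regularity_finite:
  assumes i: "i \<in> V"
  shows "(infdist y X)\<^sup>2 \<le> c * (\<Sum>j\<in>J i. prob {\<omega> \<in> space M. \<Omega> i k \<omega> = j} * (infdist y (Xc i j))\<^sup>2)"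
proof -
  let ?q = "\<lambda>j. (infdist y (Xc i j))\<^sup>2" and ?p = "\<lambda>j. prob {\<omega> \<in> space M. \<Omega> i k \<omega> = j}"
  have "(\<lambda>\<omega>. ?q (\<Omega> i k \<omega>)) \<in> borel_measurable M"
    by (rule measurable_compose[OF draw_measurable[OF i]]) simp
  then have "(\<integral>\<omega>. ?q (\<Omega> i k \<omega>) \<partial>M) = enn2real (\<integral>\<^sup>+\<omega>. ennreal (?q (\<Omega> i k \<omega>)) \<partial>M)"
    by (intro integral_eq_nn_integral) auto
  also have "(\<integral>\<^sup>+\<omega>. ennreal (?q (\<Omega> i k \<omega>)) \<partial>M) = (\<integral>\<^sup>+\<omega>. (\<Sum>j\<in>J i. ennreal (?p j) * ennreal (?q j)) \<partial>M)"
    by (rule draw_average[OF i, where \<phi> = "\<lambda>j \<omega>. ennreal (?q j)"]) simp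
  also have "\<dots> = ennreal (\<Sum>j\<in>J i. ?p j * ?q j)"
    by (simp add: emeasure_space_1 ennreal_mult[symmetric] sum_ennreal)
  also have "enn2real \<dots> = (\<Sum>j\<in>J i. ?p j * ?q j)" by (simp add: sum_nonneg)
  finally show ?thesis using regularity(2)[OF i, of y k] by simp
qed

text \<open>Apply the finite form of regularity at each outcome, then recombine the weighted sum
  over the indices into the actual draw; this is allowed because \<open>v i k\<close> and
  \<open>A\<close> are determined by the history before that draw.\<close>

lemma expected_distance_le:
  assumes i: "i \<in> V" and A: "A \<in> sets (F k)"
  shows "(\<integral>\<^sup>+\<omega>. ennreal (indicator A \<omega> * (infdist (v i k \<omega>) X)\<^sup>2) \<partial>M)
    \<le> ennreal c * (\<integral>\<^sup>+\<omega>. ennreal (indicator A \<omega> * (infdist (v i k \<omega>) (Xc i (\<Omega> i k \<omega>)))\<^sup>2) \<partial>M)"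
proof -
  let ?p = "\<lambda>j. prob {\<omega> \<in> space M. \<Omega> i k \<omega> = j}"
  define \<phi> where "\<phi> j \<omega> = ennreal (indicator A \<omega> * (infdist (v i k \<omega>) (Xc i j))\<^sup>2)" for j \<omega>
  have \<phi>: "\<phi> j \<in> borel_measurable (F k)" for j
  proof -
    have [measurable]: "(\<lambda>\<omega>. infdist (v i k \<omega>) (Xc i j)) \<in> borel_measurable (F k)" "A \<in> sets (F k)"
      using infdist_measurable[OF mix_measurable[OF i]] A by auto
    show ?thesis unfolding \<phi>_def by measurable
  qed
  have \<phi>M: "\<phi> j \<in> borel_measurable M" for j by (rule measurable_historyD[OF \<phi>])
  have "(\<integral>\<^sup>+\<omega>. ennreal (indicator A \<omega> * (infdist (v i k \<omega>) X)\<^sup>2) \<partial>M)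
      \<le> (\<integral>\<^sup>+\<omega>. ennreal c * (\<Sum>j\<in>J i. ennreal (?p j) * \<phi> j \<omega>) \<partial>M)"
  proof (rule nn_integral_mono)
    fix \<omega>
    have "indicator A \<omega> * (infdist (v i k \<omega>) X)\<^sup>2
        \<le> indicator A \<omega> * (c * (\<Sum>j\<in>J i. ?p j * (infdist (v i k \<omega>) (Xc i j))\<^sup>2))"
      by (intro mult_left_mono regularity_finite[OF i]) auto
    also have "\<dots> = c * (\<Sum>j\<in>J i. ?p j * (indicator A \<omega> * (infdist (v i k \<omega>) (Xc i j))\<^sup>2))"
      by (simp add: sum_distrib_left mult_ac)
    finally have "ennreal (indicator A \<omega> * (infdist (v i k \<omega>) X)\<^sup>2)
        \<le> ennreal (c * (\<Sum>j\<in>J i. ?p j * (indicator A \<omega> * (infdist (v i k \<omega>) (Xc i j))\<^sup>2)))"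
      by (rule ennreal_leI)
    also have "\<dots> = ennreal c * (\<Sum>j\<in>J i. ennreal (?p j) * \<phi> j \<omega>)"
    proof -
      have "(\<Sum>j\<in>J i. ennreal (?p j) * \<phi> j \<omega>)
          = (\<Sum>j\<in>J i. ennreal (?p j * (indicator A \<omega> * (infdist (v i k \<omega>) (Xc i j))\<^sup>2)))"
        by (intro sum.cong refl) (simp only: \<phi>_def ennreal_mult measure_nonneg mult_nonneg_nonneg
            indicator_pos_le zero_le_power2)
      also have "\<dots> = ennreal (\<Sum>j\<in>J i. ?p j * (indicator A \<omega> * (infdist (v i k \<omega>) (Xc i j))\<^sup>2))"
        by (intro sum_ennreal) simp
      finally show ?thesis using regularity(1) by (simp only: ennreal_mult'[symmetric] less_imp_le)
    qed
    finally show "ennreal (indicator A \<omega> * (infdist (v i k \<omega>) X)\<^sup>2)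
        \<le> ennreal c * (\<Sum>j\<in>J i. ennreal (?p j) * \<phi> j \<omega>)" .
  qed
  also have "\<dots> = ennreal c * (\<integral>\<^sup>+\<omega>. (\<Sum>j\<in>J i. ennreal (?p j) * \<phi> j \<omega>) \<partial>M)"
    using \<phi>M by (intro nn_integral_cmult borel_measurable_sum borel_measurable_times_ennreal) auto
  also have "(\<integral>\<^sup>+\<omega>. (\<Sum>j\<in>J i. ennreal (?p j) * \<phi> j \<omega>) \<partial>M) = (\<integral>\<^sup>+\<omega>. \<phi> (\<Omega> i k \<omega>) \<omega> \<partial>M)"
    using draw_average[OF i, where \<phi> = \<phi>, OF \<phi>] by simp
  finally show ?thesis by (simp add: \<phi>_def)
qed

text \<open>Restriction to \<open>A\<close> makes the initial expectation finite. At each step the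
  expected gain from the random projections outweighs the growth factor \<open>1 + e\<close>,
  leaving an error of order \<open>(\<alpha> k)\<^sup>2\<close>.\<close>

lemma summable_distance_on:
  assumes A: "A \<in> sets (F 0)" and bdd: "\<And>i \<omega>. i \<in> V \<Longrightarrow> \<omega> \<in> A \<Longrightarrow> norm (x i 0 \<omega>) \<le> R"
  shows "AE \<omega> in M. summable (\<lambda>k. indicator A \<omega> * (\<Sum>i\<in>V. (infdist (v i k \<omega>) X)\<^sup>2))"
proof -
  define h where "h k \<omega> = indicator A \<omega> * (\<Sum>i\<in>V. (infdist (v i k \<omega>) X)\<^sup>2)" for k \<omega>
  define q where "q i k \<omega> = indicator A \<omega> * (infdist (v i k \<omega>) (Xc i (\<Omega> i k \<omega>)))\<^sup>2" for i k \<omega>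
  \<comment> \<open>Chosen so that \<open>2 * e * c = 1 / 2\<close>: the expected value of the gain
    \<open>q / 2\<close> is then at least \<open>2 * e\<close> times the expected squared distance
    to \<open>X\<close>, twice the growth allowed by \<open>1 + e\<close>.\<close>
  define e where "e = 1 / (4 * c)"
  have e: "e > 0" using regularity(1) by (simp add: e_def)
  define b where "b k = real (card V) * ((1 / e + 2) * C\<^sup>2) * (\<alpha> k)\<^sup>2" for k
  have Ak: "A \<in> sets (F k)" for k 
  proof -
    have "subalgebra (F k) (F 0)" by (rule history_mono) simp
    then show ?thesis using A by (auto simp: subalgebra_def)
  qed
  have AM[measurable]: "A \<in> sets M" using A history_subalg[of 0] by (auto simp: subalgebra_def)
  have vM[measurable]: "i \<in> V \<Longrightarrow> (\<lambda>\<omega>. infdist (v i k \<omega>) S) \<in> borel_measurable M" for i k S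
    by (intro infdist_measurable measurable_historyD[OF mix_measurable])
  have q0: "0 \<le> q i k \<omega>" for i k \<omega> by (simp add: q_def)
  have h0: "0 \<le> h k \<omega>" for k \<omega> by (simp add: h_def sum_nonneg)
  have hM[measurable]: "h k \<in> borel_measurable M" for k unfolding h_def by measurable
  have qM: "q i k \<in> borel_measurable M" if i: "i \<in> V" for i k
  proof -
    have "(\<lambda>\<omega>. infdist (v i k \<omega>) (Xc i (\<Omega> i k \<omega>))) \<in> borel_measurable M"
      by (rule measurable_compose_countable'[OF vM[OF i] draw_measurable[OF i] countable_finite[OF finite_J[OF i]]])
    then show ?thesis unfolding q_def by measurable
  qed
  have mix_le: "h k \<omega> \<le> indicator A \<omega> * (\<Sum>i\<in>V. (infdist (x i k \<omega>) X)\<^sup>2)" if "\<omega> \<in> space M" for k \<omega>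
    using mixing_infdist[OF closed_X convex_X constraint_sets(3) V(1) rows[of _ k] cols[of _ k] nonneg[of _ _ k],
        where u = "\<lambda>j. x j k \<omega>"] mixing[OF _ that, of _ k]
    by (auto simp: h_def intro!: mult_left_mono)
  have ae: "AE \<omega> in M. \<forall>i\<in>V. \<forall>k. norm (g i k \<omega>) \<le> C"
    using bounded V by (intro AE_finite_allI) auto
  have "AE \<omega> in M. summable (\<lambda>k. h k \<omega>)"
  proof (rule AE_summable_of_almost_decreasing[OF hM h0 _ e])
    obtain z where z: "z \<in> X" using constraint_sets(3) by auto
    have "(\<integral>\<^sup>+\<omega>. h 0 \<omega> \<partial>M) \<le> (\<integral>\<^sup>+\<omega>. ennreal (\<Sum>i\<in>V. (R + norm z)\<^sup>2) \<partial>M)"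
    proof (rule nn_integral_mono, rule ennreal_leI)
      fix \<omega> assume \<omega>: "\<omega> \<in> space M"
      show "h 0 \<omega> \<le> (\<Sum>i\<in>V. (R + norm z)\<^sup>2)"
      proof (cases "\<omega> \<in> A")
        case True
        have "infdist (x i 0 \<omega>) X \<le> R + norm z" if "i \<in> V" for i
          using infdist_le[OF z, of "x i 0 \<omega>"] bdd[OF that True] norm_triangle_ineq4[of "x i 0 \<omega>" z]
          by (simp add: dist_norm)
        then have "(\<Sum>i\<in>V. (infdist (x i 0 \<omega>) X)\<^sup>2) \<le> (\<Sum>i\<in>V. (R + norm z)\<^sup>2)"
          by (intro sum_mono power_mono infdist_nonneg) auto
        then show ?thesis using mix_le[OF \<omega>, of 0] True by simp
      qed (simp add: h_def)
    qed
    also have "\<dots> < \<infinity>" by (simp add: emeasure_space_1)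
    finally show "(\<integral>\<^sup>+\<omega>. h 0 \<omega> \<partial>M) < \<infinity>" .
    show "summable b" unfolding b_def by (intro summable_mult steps)
    show b0: "0 \<le> b k" for k using e by (simp add: b_def)
    fix k
    \<comment> \<open>Before integration the gain refers to the sets actually drawn. Off
      \<open>A\<close> both \<open>h\<close> and \<open>q\<close> vanish, and the claim reduces to
      the sign of \<open>b k\<close>.\<close>
    have pathwise: "AE \<omega> in M. h (Suc k) \<omega> + (\<Sum>i\<in>V. q i k \<omega> / 2) \<le> (1 + e) * h k \<omega> + b k"
      using ae AE_space
    proof eventually_elim
      case (elim \<omega>)
      show ?case
      proof (cases "\<omega> \<in> A")
        case True
        have "(infdist (x i (Suc k) \<omega>) X)\<^sup>2 + (infdist (v i k \<omega>) (Xc i (\<Omega> i k \<omega>)))\<^sup>2 / 2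
            \<le> (1 + e) * (infdist (v i k \<omega>) X)\<^sup>2 + (1 / e + 2) * C\<^sup>2 * (\<alpha> k)\<^sup>2" if i: "i \<in> V" for i
          unfolding step[OF i elim(2)]
          using draw_in[OF i elim(2), of k] i elim(1)
          by (intro projected_step_infdist closed_X convex_X constraint_sets X_subset e steps) auto
        then have "(\<Sum>i\<in>V. (infdist (x i (Suc k) \<omega>) X)\<^sup>2 + q i k \<omega> / 2)
            \<le> (\<Sum>i\<in>V. (1 + e) * (infdist (v i k \<omega>) X)\<^sup>2 + (1 / e + 2) * C\<^sup>2 * (\<alpha> k)\<^sup>2)"
          using True by (intro sum_mono) (simp add: q_def)
        also have "\<dots> = (1 + e) * h k \<omega> + b k"
          using True by (simp add: h_def b_def sum.distrib sum_distrib_left)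
        finally show ?thesis
          using mix_le[OF elim(2), of "Suc k"] True by (simp add: sum.distrib)
      qed (use b0[of k] in \<open>simp add: h_def q_def\<close>)
    qed
    have "ennreal (2 * e) * (\<integral>\<^sup>+\<omega>. h k \<omega> \<partial>M)
        = (\<Sum>i\<in>V. ennreal (2 * e) * (\<integral>\<^sup>+\<omega>. ennreal (indicator A \<omega> * (infdist (v i k \<omega>) X)\<^sup>2) \<partial>M))"
    proof -
      have "(\<integral>\<^sup>+\<omega>. h k \<omega> \<partial>M) = (\<integral>\<^sup>+\<omega>. (\<Sum>i\<in>V. ennreal (indicator A \<omega> * (infdist (v i k \<omega>) X)\<^sup>2)) \<partial>M)"
        by (simp add: h_def sum_distrib_left sum_ennreal)
      also have "\<dots> = (\<Sum>i\<in>V. \<integral>\<^sup>+\<omega>. ennreal (indicator A \<omega> * (infdist (v i k \<omega>) X)\<^sup>2) \<partial>M)"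
        by (rule nn_integral_sum) measurable
      finally show ?thesis by (simp add: sum_distrib_left)
    qed
    also have "\<dots> \<le> (\<Sum>i\<in>V. \<integral>\<^sup>+\<omega>. ennreal (q i k \<omega> / 2) \<partial>M)"
    proof (rule sum_mono)
      fix i assume i: "i \<in> V"
      have "ennreal (2 * e) * (\<integral>\<^sup>+\<omega>. ennreal (indicator A \<omega> * (infdist (v i k \<omega>) X)\<^sup>2) \<partial>M)
          \<le> ennreal (2 * e) * (ennreal c * (\<integral>\<^sup>+\<omega>. ennreal (q i k \<omega>) \<partial>M))"
        unfolding q_def by (intro mult_left_mono expected_distance_le[OF i Ak]) simp
      also have "\<dots> = ennreal (1 / 2) * (\<integral>\<^sup>+\<omega>. ennreal (q i k \<omega>) \<partial>M)"
        using regularity(1) e by (simp add: mult.assoc[symmetric] ennreal_mult[symmetric] e_def)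
      also have "\<dots> = (\<integral>\<^sup>+\<omega>. ennreal (1 / 2) * ennreal (q i k \<omega>) \<partial>M)"
        using qM[OF i] by (intro nn_integral_cmult[symmetric]) measurable
      also have "\<dots> = (\<integral>\<^sup>+\<omega>. ennreal (1 / 2 * q i k \<omega>) \<partial>M)"
        by (intro nn_integral_cong ennreal_mult''[symmetric] q0)
      also have "\<dots> = (\<integral>\<^sup>+\<omega>. ennreal (q i k \<omega> / 2) \<partial>M)" by simp
      finally show "ennreal (2 * e) * (\<integral>\<^sup>+\<omega>. ennreal (indicator A \<omega> * (infdist (v i k \<omega>) X)\<^sup>2) \<partial>M)
          \<le> (\<integral>\<^sup>+\<omega>. ennreal (q i k \<omega> / 2) \<partial>M)" .
    qed
    also have "\<dots> = (\<integral>\<^sup>+\<omega>. (\<Sum>i\<in>V. ennreal (q i k \<omega> / 2)) \<partial>M)"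
      using qM by (intro nn_integral_sum[symmetric]) auto
    finally have "(\<integral>\<^sup>+\<omega>. h (Suc k) \<omega> \<partial>M) + ennreal (2 * e) * (\<integral>\<^sup>+\<omega>. h k \<omega> \<partial>M)
        \<le> (\<integral>\<^sup>+\<omega>. h (Suc k) \<omega> \<partial>M) + (\<integral>\<^sup>+\<omega>. (\<Sum>i\<in>V. ennreal (q i k \<omega> / 2)) \<partial>M)"
      by (rule add_left_mono)
    also have "\<dots> = (\<integral>\<^sup>+\<omega>. ennreal (h (Suc k) \<omega>) + (\<Sum>i\<in>V. ennreal (q i k \<omega> / 2)) \<partial>M)"
      using qM by (intro nn_integral_add[symmetric]) auto
    also have "\<dots> \<le> (\<integral>\<^sup>+\<omega>. ennreal (1 + e) * ennreal (h k \<omega>) + ennreal (b k) \<partial>M)"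
    proof (rule nn_integral_mono_AE)
      show "AE \<omega> in M. ennreal (h (Suc k) \<omega>) + (\<Sum>i\<in>V. ennreal (q i k \<omega> / 2))
          \<le> ennreal (1 + e) * ennreal (h k \<omega>) + ennreal (b k)"
        using pathwise
      proof eventually_elim
        case (elim \<omega>)
        have "ennreal (h (Suc k) \<omega>) + (\<Sum>i\<in>V. ennreal (q i k \<omega> / 2)) = ennreal (h (Suc k) \<omega> + (\<Sum>i\<in>V. q i k \<omega> / 2))"
          using h0 q0 by (simp add: sum_ennreal ennreal_plus sum_nonneg)
        also have "\<dots> \<le> ennreal ((1 + e) * h k \<omega> + b k)" using elim by (rule ennreal_leI)
        also have "\<dots> = ennreal (1 + e) * ennreal (h k \<omega>) + ennreal (b k)"
          using h0 b0 e by (simp add: ennreal_mult ennreal_plus)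
        finally show ?case .
      qed
    qed
    also have "\<dots> = (\<integral>\<^sup>+\<omega>. ennreal (1 + e) * ennreal (h k \<omega>) \<partial>M) + (\<integral>\<^sup>+\<omega>. ennreal (b k) \<partial>M)"
      by (rule nn_integral_add) measurable
    also have "\<dots> = ennreal (1 + e) * (\<integral>\<^sup>+\<omega>. h k \<omega> \<partial>M) + ennreal (b k)"
      by (simp add: nn_integral_cmult emeasure_space_1)
    finally show "(\<integral>\<^sup>+\<omega>. h (Suc k) \<omega> \<partial>M) + ennreal (2 * e) * (\<integral>\<^sup>+\<omega>. h k \<omega> \<partial>M)
        \<le> ennreal (1 + e) * (\<integral>\<^sup>+\<omega>. h k \<omega> \<partial>M) + ennreal (b k)" .
  qed
  then show ?thesis by (simp add: h_def)
qed

text \<open>Since \<open>V\<close> is finite, every outcome lies in some \<open>A R\<close>, and the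
  countably many exceptional null sets can be united.\<close>

lemma AE_summable_distance: "AE \<omega> in M. summable (\<lambda>k. \<Sum>i\<in>V. (infdist (v i k \<omega>) X)\<^sup>2)"
proof -
  define A where "A R = {\<omega> \<in> space M. \<forall>i\<in>V. norm (x i 0 \<omega>) \<le> real R}" for R :: nat
  have "A R \<in> sets (F 0)" for R
  proof -
    have [measurable]: "i \<in> V \<Longrightarrow> x i 0 \<in> borel_measurable (F 0)" for i by (rule iterate_measurable)
    have "{\<omega> \<in> space (F 0). \<forall>i\<in>V. norm (x i 0 \<omega>) \<le> real R} \<in> sets (F 0)"
      using V by measurable
    then show ?thesis by (simp add: A_def)
  qed
  then have "AE \<omega> in M. \<forall>R. summable (\<lambda>k. indicator (A R) \<omega> * (\<Sum>i\<in>V. (infdist (v i k \<omega>) X)\<^sup>2))"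
    unfolding AE_all_countable by (intro allI summable_distance_on) (auto simp: A_def)
  then show ?thesis
    using AE_space
  proof eventually_elim
    case (elim \<omega>)
    obtain R :: nat where R: "(\<Sum>i\<in>V. norm (x i 0 \<omega>)) \<le> real R" using real_arch_simple by blast
    have "norm (x i 0 \<omega>) \<le> real R" if "i \<in> V" for i
      using member_le_sum[of i V "\<lambda>i. norm (x i 0 \<omega>)"] that V R by auto
    then have "\<omega> \<in> A R" using elim(2) by (simp add: A_def)
    then show ?case using elim(1)[rule_format, of R] by simp
  qed
qed

end

section \<open>Convergence of the algorithm\<close>

theorem theorem4p1:
  fixes m n :: nat
    and V :: "nat set"
    and J :: "nat \<Rightarrow> nat set"
    and Xc :: "nat \<Rightarrow> nat \<Rightarrow> (real ^ 'd) set"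
    and f :: "nat \<Rightarrow> real ^ 'd \<Rightarrow> real"
    and E :: "nat \<Rightarrow> (nat \<times> nat) set"
    and w :: "nat \<Rightarrow> nat \<Rightarrow> nat \<Rightarrow> real"
    and \<alpha> :: "nat \<Rightarrow> real"
    and M :: "'w measure"
    and \<Omega> :: "nat \<Rightarrow> nat \<Rightarrow> 'w \<Rightarrow> nat"
    and x v g :: "nat \<Rightarrow> nat \<Rightarrow> 'w \<Rightarrow> real ^ 'd"
  assumes users: "m \<ge> 1" "V = {1..m}"
    and indices: "(\<Union>i\<in>V. J i) = {1..n}" "disjoint_family_on J V" "\<And>i. i \<in> V \<Longrightarrow> J i \<noteq> {}"
    and network: "\<And>k. E k \<subseteq> V \<times> V" "\<And>i k. i \<in> V \<Longrightarrow> i \<in> neighbours V (E k) i"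
    and prob: "prob_space M"
    \<comment> \<open>the algorithm\<close>
    and initial: "\<And>i. i \<in> V \<Longrightarrow> x i 0 \<in> borel_measurable M"
    and mixing: "\<And>i k \<omega>. i \<in> V \<Longrightarrow> \<omega> \<in> space M \<Longrightarrow>
          v i k \<omega> = (\<Sum>j\<in>neighbours V (E k) i. w i j k *\<^sub>R x j k \<omega>)"
    and subgradient: "\<And>i k \<omega>. i \<in> V \<Longrightarrow> \<omega> \<in> space M \<Longrightarrow>
          g i k \<omega> \<in> subdifferential (f i) (v i k \<omega>)"
    and adapted: "\<And>i k. i \<in> V \<Longrightarrow>
          g i k \<in> borel_measurable (history M V J (\<lambda>i. x i 0) \<Omega> k)"
    and step: "\<And>i k \<omega>. i \<in> V \<Longrightarrow> \<omega> \<in> space M \<Longrightarrow>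
          x i (Suc k) \<omega> = closest_point (Xc i (\<Omega> i k \<omega>)) (v i k \<omega> - \<alpha> k *\<^sub>R g i k \<omega>)"
    \<comment> \<open>assumption (1)\<close>
    and sets: "\<And>i j. i \<in> V \<Longrightarrow> j \<in> J i \<Longrightarrow> closed (Xc i j) \<and> convex (Xc i j)"
      "feasible_set V J Xc \<noteq> {}"
    and convex_f: "\<And>i. i \<in> V \<Longrightarrow> convex_on UNIV (f i)"
    and bounded_on_sets: "\<And>i. i \<in> V \<Longrightarrow>
          \<exists>B. \<forall>y\<in>user_set J Xc i. \<forall>h\<in>subdifferential (f i) y. norm h \<le> B"
    and bounded_on_iterates: "\<And>i. i \<in> V \<Longrightarrow>
          \<exists>C. AE \<omega> in M. \<forall>k. \<forall>h\<in>subdifferential (f i) (v i k \<omega>). norm h \<le> C"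
    and solvable: "solution_set V J Xc f \<noteq> {}"
    \<comment> \<open>assumption (2)\<close>
    and connectivity: "\<exists>Q\<ge>1. \<forall>k. strongly_connected
          (with_proj \<lparr>pverts = V, parcs = (\<Inter>l\<in>{0..Q - 1}. E (k + l))\<rparr>)"
    \<comment> \<open>assumption (3)\<close>
    and indep: "prob_space.indep_vars M (\<lambda>(i, k). count_space (J i)) (\<lambda>(i, k). \<Omega> i k) (V \<times> UNIV)"
    and indep_initial: "prob_space.indep_set M
          (sets (vimage_algebra (space M) (\<lambda>\<omega>. \<lambda>i\<in>V. x i 0 \<omega>) (\<Pi>\<^sub>M i\<in>V. borel)))
          (sets (vimage_algebra (space M) (\<lambda>\<omega>. \<lambda>(i, k)\<in>V \<times> UNIV. \<Omega> i k \<omega>)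
            (\<Pi>\<^sub>M (i, k)\<in>V \<times> UNIV. count_space (J i))))"
    and ident_distr: "\<And>i k l. i \<in> V \<Longrightarrow>
          distr M (count_space (J i)) (\<Omega> i k) = distr M (count_space (J i)) (\<Omega> i l)"
    and positive_prob: "\<And>i k j. i \<in> V \<Longrightarrow> j \<in> J i \<Longrightarrow>
          measure M {\<omega> \<in> space M. \<Omega> i k \<omega> = j} > 0"
    \<comment> \<open>assumption (4)\<close>
    and regularity: "\<exists>c>0. \<forall>i\<in>V. \<forall>y k.
          (infdist y (feasible_set V J Xc))\<^sup>2 \<le> c * (\<integral>\<omega>. (infdist y (Xc i (\<Omega> i k \<omega>)))\<^sup>2 \<partial>M)"
    \<comment> \<open>assumption (5)\<close>
    and weights_nonneg: "\<And>i j k. i \<in> V \<Longrightarrow> j \<in> V \<Longrightarrow> w i j k \<ge> 0"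
    and weights_zero: "\<And>i j k. i \<in> V \<Longrightarrow> j \<in> V \<Longrightarrow> j \<notin> neighbours V (E k) i \<Longrightarrow> w i j k = 0"
    and row_sums: "\<And>i k. i \<in> V \<Longrightarrow> (\<Sum>j\<in>V. w i j k) = 1"
    and column_sums: "\<And>j k. j \<in> V \<Longrightarrow> (\<Sum>i\<in>V. w i j k) = 1"
    and weights_lower: "\<exists>w0. 0 < w0 \<and> w0 < 1 \<and>
          (\<forall>i\<in>V. \<forall>k. \<forall>j\<in>neighbours V (E k) i. w0 \<le> w i j k)"
    and steps_pos: "\<And>k. \<alpha> k > 0"
    and steps_diverge: "filterlim (\<lambda>K. \<Sum>k<K. \<alpha> k) at_top sequentially"
    and steps_square: "summable (\<lambda>k. (\<alpha> k)\<^sup>2)"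
  shows "\<exists>xstar :: 'w \<Rightarrow> real ^ 'd.
           xstar \<in> borel_measurable M \<and>
           (\<forall>\<omega>\<in>space M. xstar \<omega> \<in> solution_set V J Xc f) \<and>
           (\<forall>i\<in>V. AE \<omega> in M. (\<lambda>k. x i k \<omega>) \<longlonglongrightarrow> xstar \<omega>)"
proof -
  interpret prob_space M by (rule prob)
  have V: "finite V" "V \<noteq> {}" using users by auto
  obtain w0 where w0: "0 < w0" "\<And>i j k. i \<in> V \<Longrightarrow> j \<in> neighbours V (E k) i \<Longrightarrow> w0 \<le> w i j k"
    using weights_lower by blast
  obtain c where c: "c > 0" "\<And>i y k. i \<in> V \<Longrightarrow> (infdist y (feasible_set V J Xc))\<^sup>2 \<le>
      c * (\<integral>\<omega>. (infdist y (Xc i (\<Omega> i k \<omega>)))\<^sup>2 \<partial>M)"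
    using regularity by blast
  have "\<exists>C'. \<forall>i\<in>V. AE \<omega> in M. \<forall>k. \<forall>h\<in>subdifferential (f i) (v i k \<omega>). norm h \<le> C' i"
    by (rule bchoice, rule ballI, rule bounded_on_iterates)
  then obtain C' where C': "\<forall>i\<in>V. AE \<omega> in M. \<forall>k. \<forall>h\<in>subdifferential (f i) (v i k \<omega>). norm h \<le> C' i"
    by (rule exE)
  have "\<exists>B'. \<forall>i\<in>V. \<forall>y\<in>user_set J Xc i. \<forall>h\<in>subdifferential (f i) y. norm h \<le> B' i"
    by (rule bchoice, rule ballI, rule bounded_on_sets)
  then obtain B' where B': "\<forall>i\<in>V. \<forall>y\<in>user_set J Xc i. \<forall>h\<in>subdifferential (f i) y. norm h \<le> B' i"
    by (rule exE)
  \<comment> \<open>Over the finite nonempty set of users the largest individual bound is a common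
    one.\<close>
  define C where "C = Max (C' ` V)"
  define B where "B = Max (B' ` V)"
  have C'_le: "C' i \<le> C" if "i \<in> V" for i using that V by (simp add: C_def)
  have B'_le: "B' i \<le> B" if "i \<in> V" for i using that V by (simp add: B_def)
  have g_le: "AE \<omega> in M. \<forall>k. norm (g i k \<omega>) \<le> C" if i: "i \<in> V" for i
    using bspec[OF C' i] AE_space
  proof eventually_elim
    case (elim \<omega>)
    show ?case
    proof
      fix k
      have "norm (g i k \<omega>) \<le> C' i" by (rule elim(1)[rule_format, OF subgradient[OF i elim(2)]])
      then show "norm (g i k \<omega>) \<le> C" using C'_le[OF i] by linarith
    qed
  qed
  have subgrad_le: "norm h \<le> B" if "i \<in> V" "y \<in> feasible_set V J Xc" "h \<in> subdifferential (f i) y" for i y h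
  proof -
    have "y \<in> user_set J Xc i" using that by (simp add: feasible_set_def)
    from order_trans[OF B'[rule_format, OF that(1) this that(3)] B'_le[OF that(1)]] show ?thesis .
  qed
  have mix: "v i k \<omega> = (\<Sum>j\<in>V. w i j k *\<^sub>R x j k \<omega>)" if "i \<in> V" "\<omega> \<in> space M" for i k \<omega>
    unfolding mixing[OF that] using V weights_zero[OF that(1)]
    by (intro sum.mono_neutral_left) (auto simp: neighbours_def)
  have reach: "V \<times> V \<subseteq> (E k)\<^sup>*" for k
  proof -
    obtain Q where "Q \<ge> 1"
      "strongly_connected (with_proj \<lparr>pverts = V, parcs = (\<Inter>l\<in>{0..Q - 1}. E (k + l))\<rparr>)"
      using connectivity by blast
    then have "(a, b) \<in> rtrancl_on V (\<Inter>l\<in>{0..Q - 1}. E (k + l))" if "a \<in> V" "b \<in> V" for a b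
      using that by (auto simp: strongly_connected_def reachable_def)
    \<comment> \<open>The index \<open>l = 0\<close> contributes the graph at time \<open>k\<close>
      itself.\<close>
    moreover have "(\<Inter>l\<in>{0..Q - 1}. E (k + l)) \<subseteq> E k" by force
    ultimately have "(a, b) \<in> (E k)\<^sup>*" if "a \<in> V" "b \<in> V" for a b
      using that rtrancl_on_rtranclI rtrancl_mono by (metis subsetD)
    then show ?thesis by auto
  qed
  have finite_index: "finite (J i)" if "i \<in> V" for i
  proof -
    have "J i \<subseteq> {1..n}" using that indices(1) by auto
    then show ?thesis by (rule finite_subset) simp
  qed
  have self_weight: "w0 \<le> w i i k" if "i \<in> V" for i k
    by (rule w0(2)[OF that network(2)[OF that]])
  have edge_weight: "w0 \<le> w i j k" if "(i, j) \<in> E k" for i j k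
    using that w0(2)[of i j k] network(1)[of k] by (auto simp: neighbours_def)
  have closed_sets: "closed (Xc i j)" and convex_sets: "convex (Xc i j)" if "i \<in> V" "j \<in> J i" for i j
    using sets(1)[OF that] by simp_all
  have steps_nonneg: "0 \<le> \<alpha> k" for k by (rule less_imp_le[OF steps_pos])
  interpret random_projection_run M V E w w0 J Xc \<alpha> \<Omega> x v g C c
    by unfold_locales (fact V row_sums column_sums weights_nonneg network(1) reach w0(1) self_weight
      edge_weight finite_index initial mix adapted step closed_sets convex_sets sets(2) g_le indep
      indep_initial c steps_nonneg steps_square)+
  let ?Z = "solution_set V J Xc f"
  \<comment> \<open>Attaining the infimum in the extended reals amounts to being minimal among all
    feasible values, the form of \<open>Z\<close> in the deterministic argument.\<close>
  have Z_eq: "?Z = {z \<in> X. \<forall>y\<in>X. (\<Sum>i\<in>V. f i z) \<le> (\<Sum>i\<in>V. f i y)}"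
  proof -
    have "ereal (objective V f z) = optimal_value V J Xc f \<longleftrightarrow> (\<forall>y\<in>X. objective V f z \<le> objective V f y)"
      if z: "z \<in> X" for z
    proof -
      have "optimal_value V J Xc f \<le> ereal (objective V f z)"
        unfolding optimal_value_def using z by (rule INF_lower)
      then have "ereal (objective V f z) = optimal_value V J Xc f
          \<longleftrightarrow> ereal (objective V f z) \<le> optimal_value V J Xc f" by auto
      then show ?thesis by (simp add: optimal_value_def le_INF_iff)
    qed
    then show ?thesis by (auto simp: solution_set_def objective_def)
  qed
  obtain z0 where z0: "z0 \<in> ?Z" using solvable by blast
  \<comment> \<open>Closedness makes the solution set Borel, which the case distinction in the
    random limit point requires for measurability.\<close>
  have closed_Z: "closed ?Z"
  proof -
    have "continuous_on UNIV (\<lambda>z. \<Sum>i\<in>V. f i z)"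
      using convex_on_continuous[OF open_UNIV convex_f] by (intro continuous_on_sum)
    then have "closed (X \<inter> (\<Inter>y\<in>X. {z. (\<Sum>i\<in>V. f i z) \<le> (\<Sum>i\<in>V. f i y)}))"
      by (intro closed_Int closed_X closed_INT ballI closed_Collect_le continuous_on_const)
    also have "X \<inter> (\<Inter>y\<in>X. {z. (\<Sum>i\<in>V. f i z) \<le> (\<Sum>i\<in>V. f i y)}) = ?Z"
      unfolding Z_eq by blast
    finally show ?thesis .
  qed
  have conv: "AE \<omega> in M. \<exists>z\<in>?Z. \<forall>i\<in>V. (\<lambda>k. x i k \<omega>) \<longlonglongrightarrow> z"
  proof -
    have "AE \<omega> in M. \<forall>i\<in>V. \<forall>k. norm (g i k \<omega>) \<le> C"
      using g_le V by (intro AE_finite_allI) auto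
    then show ?thesis
      using AE_summable_distance AE_space
    proof eventually_elim
      case (elim \<omega>)
      note \<omega> = elim(3)
      show ?case
        unfolding Z_eq
      proof (rule trajectory_convergence[where S = "\<lambda>i k. Xc i (\<Omega> i k \<omega>)" and v = "\<lambda>i k. v i k \<omega>"
            and g = "\<lambda>i k. g i k \<omega>" and \<alpha> = \<alpha> and B = B and C = C])
        show "closed (Xc i (\<Omega> i k \<omega>))" "convex (Xc i (\<Omega> i k \<omega>))" "X \<subseteq> Xc i (\<Omega> i k \<omega>)" if "i \<in> V" for i k
          using constraint_sets X_subset draw_in[OF that \<omega>] that by auto
        show "{z \<in> X. \<forall>y\<in>X. (\<Sum>i\<in>V. f i z) \<le> (\<Sum>i\<in>V. f i y)} \<noteq> {}" using z0 Z_eq by blast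
        show "v i k \<omega> = (\<Sum>j\<in>V. w i j k *\<^sub>R x j k \<omega>)" if "i \<in> V" for i k using mix that \<omega> by blast
        show "x i (Suc k) \<omega> = closest_point (Xc i (\<Omega> i k \<omega>)) (v i k \<omega> - \<alpha> k *\<^sub>R g i k \<omega>)" if "i \<in> V" for i k
          using step that \<omega> by blast
        show "g i k \<omega> \<in> subdifferential (f i) (v i k \<omega>)" if "i \<in> V" for i k using subgradient that \<omega> by blast
        show "norm (g i k \<omega>) \<le> C" if "i \<in> V" for i k using elim(1) that by blast
        show "norm h \<le> B" if "i \<in> V" "y \<in> X" "h \<in> subdifferential (f i) y" for i y h
          using subgrad_le that by blast
      qed (use closed_X convex_X convex_f steps_pos steps_diverge steps_square elim(2) in auto)
    qed
  qed
  obtain i0 where i0: "i0 \<in> V" using V by auto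
  \<comment> \<open>The limit operator is unspecified on divergent sequences, hence the default value.\<close>
  define xstar where "xstar \<omega> = (let l = lim (\<lambda>k. x i0 k \<omega>) in if l \<in> ?Z then l else z0)" for \<omega>
  show ?thesis
  proof (intro exI[of _ xstar] conjI ballI)
    have "(\<lambda>\<omega>. lim (\<lambda>k. x i0 k \<omega>)) \<in> borel_measurable M"
      by (intro borel_measurable_lim_metric measurable_historyD[OF iterate_measurable[OF i0]])
    moreover have "(\<lambda>l. if l \<in> ?Z then l else z0) \<in> borel_measurable borel"
    proof -
      have [measurable]: "?Z \<in> sets borel" using closed_Z by (rule borel_closed)
      show ?thesis by measurable
    qed
    ultimately show "xstar \<in> borel_measurable M"
      unfolding xstar_def[abs_def] Let_def by (rule measurable_compose)
    show "xstar \<omega> \<in> ?Z" for \<omega> using z0 by (simp add: xstar_def Let_def)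
    fix i assume i: "i \<in> V"
    show "AE \<omega> in M. (\<lambda>k. x i k \<omega>) \<longlonglongrightarrow> xstar \<omega>"
      using conv
    proof eventually_elim
      case (elim \<omega>)
      then obtain z where z: "z \<in> ?Z" "\<And>i. i \<in> V \<Longrightarrow> (\<lambda>k. x i k \<omega>) \<longlonglongrightarrow> z" by blast
      \<comment> \<open>The limit is common to all users, so the one read off from \<open>i0\<close>
        serves for \<open>i\<close> as well.\<close>
      have "lim (\<lambda>k. x i0 k \<omega>) = z" using z(2)[OF i0] by (rule limI)
      then have "xstar \<omega> = z" using z(1) by (simp add: xstar_def)
      then show ?case using z(2)[OF i] by simp
    qed
  qed
qed

end
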